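(* Let $S$ be an oriented $C^2$ smooth immersed surface in $\mathbb{H}^3$ with normal geodesic congruence $f:\Sigma\to\mathbb{L}(\mathbb{H}^3)$ parameterized by $\mu_2=\mu_2(\mu_1,\bar\mu_1)$. Then $S$ is flat if and only if $\mu_2$ is an anti-holomorphic function of $\mu_1$.
   Context: $\mathbb{L}(\mathbb{H}^3)$ is the space of oriented geodesics of hyperbolic 3-space $\mathbb{H}^3=\{(x^0,x^1,x^2): x^0>0\}$ with metric $\frac{(dx^0)^2+(dx^1)^2+(dx^2)^2}{(x^0)^2}$; put $z=x^1+ix^2$, $t=x^0$. It is identified with $\mathbb{P}^1\times\mathbb{P}^1-\overline{\Delta}$, $\overline{\Delta}=\{(\mu_1,\mu_2):\mu_1\bar\mu_2=-1\}$, with holomorphic coordinates $(\mu_1,\mu_2)$; the oriented geodesic with coordinates $(\mu_1,\mu_2)$ (for $\mu_2\ne0$) is parameterized by arc-length $r$ as $$z=\frac{1-\mu_1\bar\mu_2}{2\bar\mu_2}+\left(\frac{1+\mu_1\bar\mu_2}{2\bar\mu_2}\right)\tanh r,\qquad t=\frac{|1+\bar\mu_1\mu_2|}{2|\mu_2|\cosh r}.$$ The normal geodesic congruence of $S$ is the surface in $\mathbb{L}(\mathbb{H}^3)$ formed by the oriented geodesics normal to $S$; here it is assumed to be a graph $\mu_1\mapsto(\mu_1,\mu_2(\mu_1,\bar\mu_1))$. A surface $S$ in $\mathbb{H}^3$ is flat if the Gauss curvature $\kappa=\lambda_1\lambda_2-1$ of $S$ (the curvature of its induced metric, $\lambda_1,\lambda_2$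 being the principal curvatures) is zero. *)

theory Defs
  imports "HOL-Analysis.Analysis"
begin

text \<open>The following two predicates use the derivative \<open>at x\<close>, so they are meant for open sets.\<close>

definition C1_on :: "('a::real_normed_vector \<Rightarrow> 'b::real_normed_vector) \<Rightarrow> 'a set \<Rightarrow> bool" where
  "C1_on f S \<longleftrightarrow>
     (\<exists>f' :: 'a \<Rightarrow> 'a \<Rightarrow>\<^sub>L 'b. (\<forall>x\<in>S. (f has_derivative blinfun_apply (f' x)) (at x))
        \<and> continuous_on S f')"

definition C2_on :: "('a::real_normed_vector \<Rightarrow> 'b::real_normed_vector) \<Rightarrow> 'a set \<Rightarrow> bool" where
  "C2_on f S \<longleftrightarrow>
     (\<exists>f' :: 'a \<Rightarrow> 'a \<Rightarrow>\<^sub>L 'b. (\<forall>x\<in>S. (f has_derivative blinfun_apply (f' x)) (at x))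
        \<and> C1_on f' S)"

definition antiholomorphic_on :: "(complex \<Rightarrow> complex) \<Rightarrow> complex set \<Rightarrow> bool" where
  "antiholomorphic_on f U \<longleftrightarrow> (\<lambda>z. cnj (f z)) holomorphic_on U"


text \<open>The upper half-space model: a point is \<open>(z, t)\<close> with \<open>z = x\<^sup>1 + \<i> x\<^sup>2\<close> and
  \<open>t = x\<^sup>0\<close>; the inner product of \<^typ>\<open>complex \<times> real\<close> is the Euclidean one.\<close>

type_synonym pt3 = "complex \<times> real"

definition H3 :: "pt3 set" where
  "H3 = {x. snd x > 0}"

definition hyp_metric :: "pt3 \<Rightarrow> pt3 \<Rightarrow> pt3 \<Rightarrow> real" where
  "hyp_metric x v w = (v \<bullet> w) / (snd x)\<^sup>2"

text \<open>The Levi-Civita connection of \<open>hyp_metric\<close> is \<open>\<nabla>\<^sub>v W = D\<^sub>v W + hyp_christoffel x v W\<close>.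
  For a conformally flat metric \<open>e\<^bsup>2\<phi>\<^esup> \<langle>\<cdot>,\<cdot>\<rangle>\<close> the correction term is
  \<open>d\<phi>(v) W + d\<phi>(W) v - \<langle>v,W\<rangle> grad \<phi>\<close>; here \<open>\<phi> = - ln t\<close>.\<close>

definition hyp_christoffel :: "pt3 \<Rightarrow> pt3 \<Rightarrow> pt3 \<Rightarrow> pt3" where
  "hyp_christoffel x v w =
     (- 1 / snd x) *\<^sub>R (snd v *\<^sub>R w + snd w *\<^sub>R v - (v \<bullet> w) *\<^sub>R (0, 1))"


text \<open>The space of oriented geodesics in the coordinates \<open>(\<mu>\<^sub>1, \<mu>\<^sub>2)\<close>, and the arc-length
  parameterization of the geodesic with given coordinates. The geodesic runs from the ideal point
  \<open>- \<mu>\<^sub>1\<close> to the ideal point \<open>1 / cnj \<mu>\<^sub>2\<close>; for \<open>\<mu>\<^sub>2 = 0\<close> it is the upward vertical line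
  over \<open>- \<mu>\<^sub>1\<close>.\<close>

definition LH3_coords :: "(complex \<times> complex) set" where
  "LH3_coords = {(\<mu>1, \<mu>2). \<mu>1 * cnj \<mu>2 \<noteq> - 1}"

definition oriented_geodesic :: "complex \<times> complex \<Rightarrow> real \<Rightarrow> pt3" where
  "oriented_geodesic = (\<lambda>(\<mu>1, \<mu>2) r.
     if \<mu>2 = 0 then (- \<mu>1, exp r)
     else ((1 - \<mu>1 * cnj \<mu>2) / (2 * cnj \<mu>2)
             + (1 + \<mu>1 * cnj \<mu>2) / (2 * cnj \<mu>2) * complex_of_real (tanh r),
           cmod (1 + cnj \<mu>1 * \<mu>2) / (2 * cmod \<mu>2 * cosh r)))"


text \<open>A \<open>C\<^sup>2\<close> surface is a topological space \<open>\<Sigma>\<close> with an atlas \<open>A\<close> of local parameterizations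
  \<open>\<psi> : D \<rightarrow> \<Sigma>\<close> (the inverses of the coordinate charts).\<close>

type_synonym 'p atlas2 = "((real \<times> real) set \<times> (real \<times> real \<Rightarrow> 'p)) set"

definition C2_surface :: "'p topology \<Rightarrow> 'p atlas2 \<Rightarrow> bool" where
  "C2_surface \<Sigma> A \<longleftrightarrow>
     Hausdorff_space \<Sigma> \<and> second_countable \<Sigma> \<and>
     (\<Union>(D, \<psi>)\<in>A. \<psi> ` D) = topspace \<Sigma> \<and>
     (\<forall>(D, \<psi>)\<in>A. open D \<and> openin \<Sigma> (\<psi> ` D) \<and>
        homeomorphic_map (top_of_set D) (subtopology \<Sigma> (\<psi> ` D)) \<psi>) \<and>
     (\<forall>(D, \<psi>)\<in>A. \<forall>(D', \<psi>')\<in>A.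
        C2_on (inv_into D' \<psi>' \<circ> \<psi>) {u \<in> D. \<psi> u \<in> \<psi>' ` D'})"

definition C2_immersion_H3 :: "'p topology \<Rightarrow> 'p atlas2 \<Rightarrow> ('p \<Rightarrow> pt3) \<Rightarrow> bool" where
  "C2_immersion_H3 \<Sigma> A X \<longleftrightarrow>
     X ` topspace \<Sigma> \<subseteq> H3 \<and>
     (\<forall>(D, \<psi>)\<in>A. C2_on (X \<circ> \<psi>) D \<and>
        (\<forall>u\<in>D. inj (frechet_derivative (X \<circ> \<psi>) (at u))))"

text \<open>An orientation of an immersed surface in \<open>\<bbbH>\<^sup>3\<close> is a continuous unit normal field.\<close>

definition unit_normal_field ::
    "'p topology \<Rightarrow> 'p atlas2 \<Rightarrow> ('p \<Rightarrow> pt3) \<Rightarrow> ('p \<Rightarrow> pt3) \<Rightarrow> bool" where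
  "unit_normal_field \<Sigma> A X N \<longleftrightarrow>
     continuous_map \<Sigma> euclidean N \<and>
     (\<forall>p\<in>topspace \<Sigma>. hyp_metric (X p) (N p) (N p) = 1) \<and>
     (\<forall>(D, \<psi>)\<in>A. \<forall>u\<in>D. \<forall>w.
        hyp_metric (X (\<psi> u)) (N (\<psi> u)) (frechet_derivative (X \<circ> \<psi>) (at u) w) = 0)"

definition oriented_C2_immersed_surface ::
    "'p topology \<Rightarrow> 'p atlas2 \<Rightarrow> ('p \<Rightarrow> pt3) \<Rightarrow> ('p \<Rightarrow> pt3) \<Rightarrow> bool" where
  "oriented_C2_immersed_surface \<Sigma> A X N \<longleftrightarrow>
     C2_surface \<Sigma> A \<and> C2_immersion_H3 \<Sigma> A X \<and> unit_normal_field \<Sigma> A X N"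


text \<open>Curvature, for a local parameterization \<open>x\<close> of the surface with unit normal \<open>n\<close> along it.
  The covariant derivative is that of \<open>n\<close> in the direction \<open>dx(w)\<close>; the shape operator is
  \<open>dx(w) \<mapsto> - \<nabla>\<^sub>w n\<close>.\<close>

definition cov_deriv ::
    "(real \<times> real \<Rightarrow> pt3) \<Rightarrow> (real \<times> real \<Rightarrow> pt3) \<Rightarrow> real \<times> real \<Rightarrow> real \<times> real \<Rightarrow> pt3" where
  "cov_deriv x n u w =
     frechet_derivative n (at u) w
       + hyp_christoffel (x u) (frechet_derivative x (at u) w) (n u)"

definition principal_curvatures ::
    "(real \<times> real \<Rightarrow> pt3) \<Rightarrow> (real \<times> real \<Rightarrow> pt3) \<Rightarrow> real \<times> real \<Rightarrow> real \<Rightarrow> real \<Rightarrow> bool" where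
  "principal_curvatures x n u k1 k2 \<longleftrightarrow>
     (\<exists>w1 w2. let e1 = frechet_derivative x (at u) w1; e2 = frechet_derivative x (at u) w2 in
        hyp_metric (x u) e1 e1 = 1 \<and> hyp_metric (x u) e2 e2 = 1 \<and> hyp_metric (x u) e1 e2 = 0 \<and>
        - cov_deriv x n u w1 = k1 *\<^sub>R e1 \<and> - cov_deriv x n u w2 = k2 *\<^sub>R e2)"

definition gauss_curvature ::
    "(real \<times> real \<Rightarrow> pt3) \<Rightarrow> (real \<times> real \<Rightarrow> pt3) \<Rightarrow> real \<times> real \<Rightarrow> real" where
  "gauss_curvature x n u =
     (THE \<kappa>. \<exists>k1 k2. principal_curvatures x n u k1 k2 \<and> \<kappa> = k1 * k2 - 1)"

definition flat_surface :: "'p atlas2 \<Rightarrow> ('p \<Rightarrow> pt3) \<Rightarrow> ('p \<Rightarrow> pt3) \<Rightarrow> bool" where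
  "flat_surface A X N \<longleftrightarrow>
     (\<forall>(D, \<psi>)\<in>A. \<forall>u\<in>D. gauss_curvature (X \<circ> \<psi>) (N \<circ> \<psi>) u = 0)"


text \<open>\<open>f\<close> assigns to each point \<open>p\<close> of the surface the oriented geodesic through \<open>X p\<close> with
  velocity \<open>N p\<close> there. That \<open>f\<close> takes values in \<open>LH3_coords\<close> means that the coordinates
  \<open>\<mu>\<^sub>1\<close> and \<open>\<mu>\<^sub>2\<close> are both finite along the congruence.\<close>

definition normal_geodesic_congruence ::
    "'p topology \<Rightarrow> ('p \<Rightarrow> pt3) \<Rightarrow> ('p \<Rightarrow> pt3) \<Rightarrow> ('p \<Rightarrow> complex \<times> complex) \<Rightarrow> bool" where
  "normal_geodesic_congruence \<Sigma> X N f \<longleftrightarrow>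
     (\<forall>p\<in>topspace \<Sigma>. f p \<in> LH3_coords \<and>
        (\<exists>r. oriented_geodesic (f p) r = X p \<and>
             (oriented_geodesic (f p) has_vector_derivative N p) (at r)))"

text \<open>Differentiability is over the reals. Only the image of \<open>f\<close> is required to be a graph; \<open>f\<close>
  itself need not be injective.\<close>

definition congruence_graph ::
    "'p topology \<Rightarrow> ('p \<Rightarrow> complex \<times> complex) \<Rightarrow> complex set \<Rightarrow> (complex \<Rightarrow> complex) \<Rightarrow> bool" where
  "congruence_graph \<Sigma> f U \<mu>2 \<longleftrightarrow>
     open U \<and> \<mu>2 differentiable_on U \<and> f ` topspace \<Sigma> = (\<lambda>\<mu>1. (\<mu>1, \<mu>2 \<mu>1)) ` U"

end

theory Submission
  imports Defs
begin

text \<open>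
  The theorem is pointwise: at every point of the surface the Gauss curvature vanishes if and only
  if the real differential of \<open>\<mu>\<^sub>2\<close>, taken at the corresponding \<open>\<mu>\<^sub>1\<close>, has no complex linear
  part. Since the congruence is the whole graph of \<open>\<mu>\<^sub>2\<close> over \<open>U\<close>, every point of \<open>U\<close> is
  reached, and the theorem follows.

  The pointwise statement comes from following the two ideal endpoints of the normal geodesic.
  Write \<open>x = (z, t)\<close> for the position, \<open>n\<close> for the unit normal, and \<open>w\<close> for the stereographic
  coordinate of the direction of \<open>n\<close>. Then (\<open>geodesic_coords\<close>)
  \<open>\<mu>\<^sub>1 = t w - z\<close> and \<open>\<mu>\<^sub>2 = w / (t + cnj z w)\<close>. The real-linear map \<open>L = tangent_coord w\<close>
  identifies the tangent plane conformally with \<open>\<complex>\<close> and kills the normal. Differentiating the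
  two formulas along the surface, with \<open>E = (t + cnj z w)\<^sup>2\<close>, gives
  \<open>2 d\<mu>\<^sub>1 = L(\<nabla>n) - L(dx)\<close> and \<open>2 E d\<mu>\<^sub>2 = L(\<nabla>n) + L(dx)\<close>
  (\<open>tangent_coord_cov_deriv\<close>): a Jacobi field is the sum of its exponentially growing and decaying parts,
  which move the forward and the backward endpoint, respectively.

  In the coordinate \<open>\<zeta> = L(dx)\<close> the shape operator \<open>- \<nabla>n\<close> is a symmetric real-linear map of
  \<open>\<complex>\<close>, so it has the form \<open>\<zeta> \<mapsto> p \<zeta> + b cnj \<zeta>\<close> with \<open>p\<close> real, and its determinant is
  \<open>p\<^sup>2 - \<bar>b\<bar>\<^sup>2\<close>; hence \<open>\<kappa> = p\<^sup>2 - \<bar>b\<bar>\<^sup>2 - 1\<close> (\<open>gauss_curvature_eq\<close>). If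
  \<open>d\<mu>\<^sub>2 = a d\<mu>\<^sub>1 + c cnj d\<mu>\<^sub>1\<close>, then comparing coefficients and eliminating \<open>c\<close> yields
  \<open>E a ((p + 1)\<^sup>2 - \<bar>b\<bar>\<^sup>2) = \<kappa>\<close> (\<open>no_holomorphic_part_iff\<close>). The second factor is the determinant of
  \<open>\<zeta> \<mapsto> - 2 d\<mu>\<^sub>1\<close>, which is nonzero: a direction with \<open>d\<mu>\<^sub>1 = 0\<close> has
  \<open>d\<mu>\<^sub>2 = 0\<close> as well, because the congruence lies on a graph, and then \<open>\<zeta> = 0\<close>. So \<open>\<kappa> = 0\<close> if and only if \<open>a = 0\<close>.

  Two regularity facts are needed to start. The unit normal is only assumed continuous; it is
  differentiable because it is locally a constant sign times the normalized cross product of the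
  partial derivatives of \<open>x\<close> (\<open>n_differentiable\<close>). The shape operator is symmetric because second
  derivatives are (\<open>second_derivative_symmetric\<close>).
\<close>

section \<open>Symmetry of second derivatives\<close>

text \<open>By the mean value theorem in the direction \<open>v\<close>, the second difference is \<open>s\<close> times an increment
  of \<open>y \<mapsto> g' y v\<close> along \<open>s w\<close>. Differentiability of that map at \<open>u\<close>
  bounds the error by \<open>o(s\<^sup>2)\<close>.\<close>

lemma second_difference_tendsto:
  fixes g :: "'a::real_normed_vector \<Rightarrow> real"
  assumes S: "open S" "u \<in> S"
    and g: "\<And>y. y \<in> S \<Longrightarrow> (g has_derivative g' y) (at y)"
    and G: "((\<lambda>y. g' y v) has_derivative G') (at u)"
  shows "((\<lambda>s. (g (u + s *\<^sub>R v + s *\<^sub>R w) - g (u + s *\<^sub>R v) - g (u + s *\<^sub>R w) + g u) / s\<^sup>2)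
            \<longlongrightarrow> G' w) (at_right 0)"
proof (rule tendstoI)
  fix e :: real assume "e > 0"
  define K where "K = norm v + norm w + 1"
  have K: "K > 0" "norm v \<le> K" "norm w \<le> K" "norm v + norm w \<le> K"
    using norm_ge_zero[of v] norm_ge_zero[of w] unfolding K_def by linarith+
  define e' where "e' = e / (4 * K)"
  have e': "e' > 0" using K \<open>e > 0\<close> by (simp add: e'_def)
  have lin: "linear G'" using G has_derivative_linear by blast
  obtain d1 where d1: "d1 > 0"
      "\<And>y. norm (y - u) < d1 \<Longrightarrow> norm (g' y v - g' u v - G' (y - u)) \<le> e' * norm (y - u)"
    using G e' unfolding has_derivative_at_alt by blast
  obtain d2 where d2: "d2 > 0" "ball u d2 \<subseteq> S" using S by (meson openE)
  define d where "d = min d1 d2 / K"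
  have "d > 0" using d1 d2 K by (simp add: d_def)
  have main: "dist ((g (u + s *\<^sub>R v + s *\<^sub>R w) - g (u + s *\<^sub>R v) - g (u + s *\<^sub>R w) + g u) / s\<^sup>2) (G' w) < e"
    if s: "0 < s" "s < d" for s
  proof -
    \<comment> \<open>\<open>d\<close> is chosen so that all points \<open>u + h\<close> used below stay in \<open>S\<close> and where the linear
      approximation of \<open>y \<mapsto> g' y v\<close> is \<open>e'\<close>-accurate\<close>
    have small: "norm (h::'a) < d1 \<and> u + h \<in> S \<and> norm h \<le> s * K"
      if h: "norm h \<le> s * (norm v + norm w)" for h
    proof -
      have 1: "norm h \<le> s * K" using h K s by (meson less_eq_real_def mult_left_mono order_trans)
      have 2: "s * K < min d1 d2" using s K by (simp add: d_def pos_less_divide_eq)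
      have "u + h \<in> ball u d2" using 1 2 by (simp add: dist_norm)
      then show ?thesis using 1 2 d2 by auto
    qed
    have n1: "norm ((\<tau> * s) *\<^sub>R v + s *\<^sub>R w) \<le> s * (norm v + norm w)"
        and n2: "norm ((\<tau> * s) *\<^sub>R v) \<le> s * (norm v + norm w)" if "0 \<le> \<tau>" "\<tau> \<le> 1" for \<tau>
    proof -
      have a: "norm ((\<tau> * s) *\<^sub>R v) \<le> s * norm v"
        using that s by (simp add: mult_right_mono)
      have b: "norm (s *\<^sub>R w) = s * norm w" using s by simp
      show "norm ((\<tau> * s) *\<^sub>R v + s *\<^sub>R w) \<le> s * (norm v + norm w)"
        using norm_triangle_le[OF add_mono[OF a eq_refl[OF b]]] by (simp only: distrib_left)
      show "norm ((\<tau> * s) *\<^sub>R v) \<le> s * (norm v + norm w)"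
        using a s by (smt (verit) distrib_left mult_nonneg_nonneg norm_ge_zero)
    qed
    define \<phi> where "\<phi> \<tau> = g (u + ((\<tau> * s) *\<^sub>R v + s *\<^sub>R w)) - g (u + (\<tau> * s) *\<^sub>R v)" for \<tau>
    define \<phi>' where "\<phi>' \<tau> = s * (g' (u + ((\<tau> * s) *\<^sub>R v + s *\<^sub>R w)) v - g' (u + (\<tau> * s) *\<^sub>R v) v)" for \<tau>
    have der: "DERIV \<phi> \<tau> :> \<phi>' \<tau>" if "0 \<le> \<tau>" "\<tau> \<le> 1" for \<tau>
    proof -
      have in1: "u + ((\<tau> * s) *\<^sub>R v + s *\<^sub>R w) \<in> S" and in2: "u + (\<tau> * s) *\<^sub>R v \<in> S"
        using small n1 n2 that by blast+
      have A: "((\<lambda>\<tau>. g (u + ((\<tau> * s) *\<^sub>R v + s *\<^sub>R w))) has_derivative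
          (\<lambda>h. g' (u + ((\<tau> * s) *\<^sub>R v + s *\<^sub>R w)) ((h * s) *\<^sub>R v))) (at \<tau>)"
        by (rule has_derivative_compose[where f = "\<lambda>\<tau>. u + ((\<tau> * s) *\<^sub>R v + s *\<^sub>R w)", OF _ g[OF in1]]) (auto intro!: derivative_eq_intros)
      have B: "((\<lambda>\<tau>. g (u + (\<tau> * s) *\<^sub>R v)) has_derivative
          (\<lambda>h. g' (u + (\<tau> * s) *\<^sub>R v) ((h * s) *\<^sub>R v))) (at \<tau>)"
        by (rule has_derivative_compose[where f = "\<lambda>\<tau>. u + (\<tau> * s) *\<^sub>R v", OF _ g[OF in2]]) (auto intro!: derivative_eq_intros)
      have l: "linear (g' (u + ((\<tau> * s) *\<^sub>R v + s *\<^sub>R w)))" "linear (g' (u + (\<tau> * s) *\<^sub>R v))"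
        using g in1 in2 has_derivative_linear by blast+
      show ?thesis
        unfolding has_field_derivative_def \<phi>_def \<phi>'_def
        by (rule has_derivative_eq_rhs[OF has_derivative_diff[OF A B]])
          (simp add: fun_eq_iff linear_scale[OF l(1)] linear_scale[OF l(2)] right_diff_distrib mult_ac)
    qed
    obtain \<tau> where \<tau>: "0 < \<tau>" "\<tau> < 1" "\<phi> 1 - \<phi> 0 = (1 - 0) * \<phi>' \<tau>"
      using MVT2[of 0 1 \<phi> \<phi>'] der by auto
    define h1 where "h1 = (\<tau> * s) *\<^sub>R v + s *\<^sub>R w"
    define h2 where "h2 = (\<tau> * s) *\<^sub>R v"
    have h1: "norm h1 < d1" "norm h1 \<le> s * K" and h2: "norm h2 < d1" "norm h2 \<le> s * K"
      using small[OF n1[of \<tau>]] small[OF n2[of \<tau>]] \<tau>(1,2) unfolding h1_def h2_def by auto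
    have e1: "norm (g' (u + h1) v - g' u v - G' h1) \<le> e' * (s * K)"
      using d1(2)[of "u + h1"] h1 e' by (smt (verit) add_diff_cancel_left' mult_left_mono)
    have e2: "norm (g' (u + h2) v - g' u v - G' h2) \<le> e' * (s * K)"
      using d1(2)[of "u + h2"] h2 e' by (smt (verit) add_diff_cancel_left' mult_left_mono)
    have "G' h1 - G' h2 = s * G' w"
      by (simp add: h1_def h2_def linear_add[OF lin] linear_scale[OF lin])
    then have e3: "\<bar>(g' (u + h1) v - g' (u + h2) v) - s * G' w\<bar> \<le> 2 * e' * (s * K)"
      using e1 e2 by (simp add: abs_le_iff)
    have \<Delta>: "g (u + s *\<^sub>R v + s *\<^sub>R w) - g (u + s *\<^sub>R v) - g (u + s *\<^sub>R w) + g u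
        = s * (g' (u + h1) v - g' (u + h2) v)"
      using \<tau>(3) by (simp add: \<phi>_def \<phi>'_def h1_def h2_def algebra_simps)
    have "(s * (g' (u + h1) v - g' (u + h2) v)) / s\<^sup>2 - G' w
        = ((g' (u + h1) v - g' (u + h2) v) - s * G' w) / s"
      using s by (simp add: field_simps power2_eq_square)
    moreover have "\<bar>((g' (u + h1) v - g' (u + h2) v) - s * G' w) / s\<bar> \<le> 2 * e' * K"
      using e3 s by (simp add: pos_divide_le_eq mult_ac)
    moreover have "2 * e' * K < e" using K \<open>e > 0\<close> by (simp add: e'_def)
    ultimately show ?thesis unfolding \<Delta> by (simp add: dist_real_def)
  qed
  show "\<forall>\<^sub>F s in at_right 0. dist ((g (u + s *\<^sub>R v + s *\<^sub>R w) - g (u + s *\<^sub>R v)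
      - g (u + s *\<^sub>R w) + g u) / s\<^sup>2) (G' w) < e"
    unfolding eventually_at_right_field using main \<open>d > 0\<close> by blast
qed

text \<open>The second difference is symmetric in \<open>v\<close> and \<open>w\<close>, so its two limits agree.\<close>

lemma second_derivative_symmetric:
  fixes g :: "'a::real_normed_vector \<Rightarrow> real"
  assumes S: "open S" "u \<in> S"
    and g: "\<And>y. y \<in> S \<Longrightarrow> (g has_derivative g' y) (at y)"
    and G: "((\<lambda>y. g' y v) has_derivative G') (at u)"
    and H: "((\<lambda>y. g' y w) has_derivative H') (at u)"
  shows "G' w = H' v"
proof (rule tendsto_unique)
  show "((\<lambda>s. (g (u + s *\<^sub>R v + s *\<^sub>R w) - g (u + s *\<^sub>R v) - g (u + s *\<^sub>R w) + g u) / s\<^sup>2)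
            \<longlongrightarrow> G' w) (at_right 0)"
    by (rule second_difference_tendsto[OF S g G])
  have "((\<lambda>s. (g (u + s *\<^sub>R w + s *\<^sub>R v) - g (u + s *\<^sub>R w) - g (u + s *\<^sub>R v) + g u) / s\<^sup>2)
            \<longlongrightarrow> H' v) (at_right 0)"
    by (rule second_difference_tendsto[OF S g H])
  then show "((\<lambda>s. (g (u + s *\<^sub>R v + s *\<^sub>R w) - g (u + s *\<^sub>R v) - g (u + s *\<^sub>R w) + g u) / s\<^sup>2)
            \<longlongrightarrow> H' v) (at_right 0)"
    by (simp add: algebra_simps)
qed simp

section \<open>Real-linear maps of the complex plane\<close>

lemma real_linear_complex_decomposition:
  fixes B :: "complex \<Rightarrow> complex"
  assumes "linear B"
  obtains p b where "\<And>\<zeta>. B \<zeta> = p * \<zeta> + b * cnj \<zeta>"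
proof
  fix \<zeta>
  have "B \<zeta> = B (Re \<zeta> *\<^sub>R 1 + Im \<zeta> *\<^sub>R \<i>)"
    by (metis complex_eq mult.commute scaleR_conv_of_real mult.right_neutral)
  also have "\<dots> = of_real (Re \<zeta>) * B 1 + of_real (Im \<zeta>) * B \<i>"
    unfolding linear_add[OF assms] linear_scale[OF assms] by (simp add: scaleR_conv_of_real)
  also have "\<dots> = (B 1 - \<i> * B \<i>) / 2 * \<zeta> + (B 1 + \<i> * B \<i>) / 2 * cnj \<zeta>"
    by (simp add: complex_eq_iff field_simps)
  finally show "B \<zeta> = (B 1 - \<i> * B \<i>) / 2 * \<zeta> + (B 1 + \<i> * B \<i>) / 2 * cnj \<zeta>" .
qed

text \<open>The real differential of \<open>cnj \<circ> h\<close> is \<open>\<zeta> \<mapsto> cnj a cnj \<zeta> + cnj c \<zeta>\<close>, so complex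
  differentiability of \<open>cnj \<circ> h\<close> is the vanishing of the complex linear part \<open>a\<close> of the differential of \<open>h\<close>.\<close>

lemma complex_differentiable_cnj_iff:
  fixes h :: "complex \<Rightarrow> complex"
  assumes "(h has_derivative (\<lambda>\<zeta>. a * \<zeta> + c * cnj \<zeta>)) (at z)"
  shows "(\<lambda>z. cnj (h z)) field_differentiable (at z) \<longleftrightarrow> a = 0"
proof
  have der: "((\<lambda>z. cnj (h z)) has_derivative (\<lambda>\<zeta>. cnj (a * \<zeta> + c * cnj \<zeta>))) (at z)"
    using assms by (rule has_derivative_cnj)
  show "(\<lambda>z. cnj (h z)) field_differentiable (at z)" if "a = 0"
    using der that unfolding field_differentiable_def has_field_derivative_def
    by (intro exI[of _ "cnj c"]) simp
  assume "(\<lambda>z. cnj (h z)) field_differentiable (at z)"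
  then obtain k where "((\<lambda>z. cnj (h z)) has_derivative (*) k) (at z)"
    unfolding field_differentiable_def has_field_derivative_def by blast
  then have eq: "(\<lambda>\<zeta>. cnj (a * \<zeta> + c * cnj \<zeta>)) = (*) k"
    using der has_derivative_unique by blast
  have "cnj a + cnj c = k" "\<i> * (cnj c - cnj a) = \<i> * k"
    using fun_cong[OF eq, of 1] fun_cong[OF eq, of \<i>] by (simp_all add: algebra_simps)
  then have "2 * cnj a = 0" by auto
  then show "a = 0" by simp
qed

text \<open>A symmetric real-linear map \<open>\<zeta> \<mapsto> p \<zeta> + b cnj \<zeta>\<close> is diagonalized by the eigenvectors of its
  antilinear part: if \<open>\<rho>\<^sup>2 = b / \<bar>b\<bar>\<close>, then \<open>\<rho>\<close> and \<open>\<i> \<rho>\<close> have the eigenvalues \<open>\<bar>b\<bar>\<close> and \<open>- \<bar>b\<bar>\<close>.\<close>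

lemma antilinear_eigenvector:
  fixes b :: complex
  obtains \<rho> where "cmod \<rho> = 1" "b * cnj \<rho> = of_real (cmod b) * \<rho>"
proof (cases "b = 0")
  case True
  then show ?thesis using that[of 1] by simp
next
  case False
  define \<rho> where "\<rho> = csqrt (sgn b)"
  have sq: "\<rho> * \<rho> = sgn b" by (simp add: \<rho>_def flip: power2_eq_square)
  have "(cmod \<rho>)\<^sup>2 = 1" using False arg_cong[OF sq, of cmod] by (simp add: norm_mult norm_sgn power2_eq_square)
  then have norm: "cmod \<rho> = 1" by (simp add: power2_eq_1_iff) (smt (verit) norm_ge_zero)
  have polar: "b = of_real (cmod b) * (\<rho> * \<rho>)"
    using False unfolding sq by (simp add: sgn_eq)
  have "b * cnj \<rho> = of_real (cmod b) * (\<rho> * \<rho>) * cnj \<rho>"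
    by (rule arg_cong[OF polar, of "\<lambda>\<zeta>. \<zeta> * cnj \<rho>"])
  also have "\<dots> = of_real (cmod b) * \<rho> * (\<rho> * cnj \<rho>)" by (simp only: mult.assoc)
  also have "\<rho> * cnj \<rho> = 1" using norm by (simp flip: complex_norm_square)
  finally show ?thesis using that norm by simp
qed

text \<open>Orthogonality of the eigenvectors forces the antilinear part to act on them by opposite
  scalars \<open>\<plusminus>\<delta>\<close>, and \<open>\<bar>\<delta>\<bar> = \<bar>b\<bar>\<close> because \<open>\<zeta> \<mapsto> b cnj \<zeta>\<close> scales all lengths by \<open>\<bar>b\<bar>\<close>. So any
  pair of principal directions gives the same product.\<close>

lemma antilinear_eigenvalue_product:
  fixes p k1 k2 :: real and b :: complex
  assumes "c > 0" "cmod \<zeta>1 = c" "cmod \<zeta>2 = c" "\<zeta>1 \<bullet> \<zeta>2 = 0"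
    and 1: "of_real p * \<zeta>1 + b * cnj \<zeta>1 = of_real k1 * \<zeta>1"
    and 2: "of_real p * \<zeta>2 + b * cnj \<zeta>2 = of_real k2 * \<zeta>2"
  shows "k1 * k2 = p\<^sup>2 - (cmod b)\<^sup>2"
proof -
  define \<delta> where "\<delta> = k1 - p"
  have nz: "\<zeta>1 \<noteq> 0" "\<zeta>2 \<noteq> 0" using assms by auto
  have e1: "b * cnj \<zeta>1 = of_real (k1 - p) * \<zeta>1" and e2: "b * cnj \<zeta>2 = of_real (k2 - p) * \<zeta>2"
    using 1 2 by (simp_all add: algebra_simps)
  have "\<zeta>1 * cnj \<zeta>2 + \<zeta>2 * cnj \<zeta>1 = 0"
    using assms(4) by (simp add: complex_eq_iff inner_complex_def algebra_simps)
  moreover have "of_real (k1 - p) * (\<zeta>1 * cnj \<zeta>2) = of_real (k2 - p) * (\<zeta>2 * cnj \<zeta>1)"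
  proof -
    have "of_real (k1 - p) * (\<zeta>1 * cnj \<zeta>2) = (b * cnj \<zeta>1) * cnj \<zeta>2" by (simp only: e1 mult.assoc)
    also have "\<dots> = (b * cnj \<zeta>2) * cnj \<zeta>1" by (simp only: mult_ac)
    also have "\<dots> = of_real (k2 - p) * (\<zeta>2 * cnj \<zeta>1)" by (simp only: e2 mult.assoc)
    finally show ?thesis .
  qed
  ultimately have "of_real (k1 - p + (k2 - p)) * (\<zeta>1 * cnj \<zeta>2) = 0"
    unfolding of_real_add by algebra
  then have "complex_of_real (k1 - p + (k2 - p)) = 0" using nz by auto
  then have k2: "k2 = p - \<delta>" unfolding of_real_eq_0_iff by (simp add: \<delta>_def)
  have "cmod b * cmod \<zeta>1 = \<bar>\<delta>\<bar> * cmod \<zeta>1"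
    using arg_cong[OF e1, of cmod] by (simp only: norm_mult complex_mod_cnj norm_of_real \<delta>_def)
  then have "(cmod b)\<^sup>2 = \<delta>\<^sup>2" using nz by simp
  then show ?thesis unfolding k2 by (simp add: \<delta>_def power2_eq_square algebra_simps)
qed

text \<open>With \<open>M = p + b cnj\<close> the shape operator in a complex
  tangent coordinate, \<open>M + 1\<close> and \<open>M - 1\<close> are, up to constant factors, the variations of the two
  endpoints, and \<open>a + c cnj\<close> is the differential of the graph that carries one into the other.
  The proof eliminates \<open>c\<close> from the two coefficient equations.\<close>

lemma no_holomorphic_part_iff:
  fixes p :: real and a b c E :: complex
  assumes E: "E \<noteq> 0"
    and eq: "\<And>\<zeta>. E * (a * (of_real p * \<zeta> + b * cnj \<zeta> + \<zeta>) + c * cnj (of_real p * \<zeta> + b * cnj \<zeta> + \<zeta>))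
        = of_real p * \<zeta> + b * cnj \<zeta> - \<zeta>"
  shows "p\<^sup>2 - (cmod b)\<^sup>2 - 1 = 0 \<longleftrightarrow> a = 0"
proof -
  define q where "q = complex_of_real p"
  have f1: "E * (a * (q + b + 1) + c * (q + cnj b + 1)) = q + b - 1"
    using eq[of 1] by (simp add: q_def)
  have "\<i> * (E * (a * (q - b + 1) - c * (q - cnj b + 1))) = \<i> * (q - b - 1)"
    using eq[of \<i>] by (simp add: q_def algebra_simps)
  then have f2: "E * (a * (q - b + 1) - c * (q - cnj b + 1)) = q - b - 1"
    by simp
  have "2 * (E * (a * (q + 1) + c * cnj b)) = 2 * (q - 1)"
      and "2 * (E * (a * b + c * (q + 1))) = 2 * b"
    using arg_cong2[OF f1 f2, of "(+)"] arg_cong2[OF f1 f2, of "(-)"] by (simp_all add: algebra_simps)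
  then have 1: "E * (a * (q + 1) + c * cnj b) = q - 1" and 2: "E * (a * b + c * (q + 1)) = b"
    by (simp_all only: mult_cancel_left) simp_all
  have "E * a * ((q + 1)\<^sup>2 - b * cnj b)
      = (q + 1) * (E * (a * (q + 1) + c * cnj b)) - cnj b * (E * (a * b + c * (q + 1)))"
    by (simp add: power2_eq_square algebra_simps)
  also have "\<dots> = q\<^sup>2 - b * cnj b - 1"
    unfolding 1 2 by (simp add: power2_eq_square algebra_simps)
  finally have det: "E * a * ((q + 1)\<^sup>2 - b * cnj b) = q\<^sup>2 - b * cnj b - 1" .
  \<comment> \<open>This is the determinant of \<open>M + 1\<close>. If \<open>M \<zeta> + \<zeta> = 0\<close>, the hypothesis gives
    \<open>M \<zeta> - \<zeta> = 0\<close> too, whence \<open>\<zeta> = 0\<close>.\<close>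
  have "(q + 1)\<^sup>2 - b * cnj b \<noteq> 0"
  proof
    assume 0: "(q + 1)\<^sup>2 - b * cnj b = 0"
    \<comment> \<open>\<open>q + 1 - b\<close> spans the kernel of \<open>M + 1\<close>, unless it vanishes; then \<open>b\<close> is real and \<open>\<i>\<close> is in
      the kernel\<close>
    have "\<exists>\<zeta>. \<zeta> \<noteq> 0 \<and> q * \<zeta> + b * cnj \<zeta> + \<zeta> = 0"
    proof (cases "q + 1 = b")
      case True
      then have "cnj b = b" by (metis q_def complex_cnj_add complex_cnj_complex_of_real complex_cnj_one)
      with True show ?thesis by (intro exI[of _ \<i>]) (simp add: algebra_simps flip: True)
    next
      case False
      have "q * (q + 1 - b) + b * cnj (q + 1 - b) + (q + 1 - b) = 0"
        using 0 by (simp add: q_def power2_eq_square algebra_simps)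
      with False show ?thesis by (intro exI[of _ "q + 1 - b"]) simp
    qed
    then obtain \<zeta> where \<zeta>: "\<zeta> \<noteq> 0" "q * \<zeta> + b * cnj \<zeta> + \<zeta> = 0" by blast
    then have "q * \<zeta> + b * cnj \<zeta> - \<zeta> = 0" using eq[of \<zeta>] by (simp add: q_def)
    then have "2 * \<zeta> = 0" using \<zeta>(2) by (simp add: algebra_simps)
    with \<zeta> show False by simp
  qed
  moreover have "q\<^sup>2 - b * cnj b - 1 = of_real (p\<^sup>2 - (cmod b)\<^sup>2 - 1)"
    by (simp add: q_def flip: complex_norm_square)
  ultimately show ?thesis using det E by (metis mult_eq_0_iff of_real_eq_0_iff)
qed

section \<open>Stereographic coordinate of the normal direction\<close>

text \<open>For a unit normal with stereographic coordinate \<open>w\<close>, this is a complex coordinate on the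
  tangent plane. Up to a factor \<open>2\<close> it inverts the differential at \<open>w\<close> of inverse stereographic projection
  \<open>w \<mapsto> inv_stereo w / (1 + \<bar>w\<bar>\<^sup>2)\<close>; it is defined on all of \<open>\<real>\<^sup>3\<close> by sending the normal
  direction to \<open>0\<close>.\<close>

definition tangent_coord :: "complex \<Rightarrow> pt3 \<Rightarrow> complex" where
  "tangent_coord w y = fst y - w\<^sup>2 * cnj (fst y) - 2 * w * complex_of_real (snd y)"

text \<open>Inverse stereographic projection without the normalizing factor \<open>1 / (1 + \<bar>w\<bar>\<^sup>2)\<close>; the
  excluded direction, \<open>w = \<infinity>\<close>, is straight down.\<close>

definition inv_stereo :: "complex \<Rightarrow> pt3" where
  "inv_stereo w = (2 * w, 1 - (cmod w)\<^sup>2)"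

lemma linear_tangent_coord: "linear (tangent_coord w)"
  by (rule linearI) (simp_all add: tangent_coord_def algebra_simps scaleR_conv_of_real)

text \<open>A polynomial identity, stating that \<open>tangent_coord w\<close> is \<open>1 + \<bar>w\<bar>\<^sup>2\<close> times the orthogonal projection along
  \<open>inv_stereo w\<close> followed by an isometry onto \<open>\<complex>\<close>.\<close>

lemma tangent_coord_inner:
  "tangent_coord w y1 \<bullet> tangent_coord w y2 = (1 + (cmod w)\<^sup>2)\<^sup>2 * (y1 \<bullet> y2) - (inv_stereo w \<bullet> y1) * (inv_stereo w \<bullet> y2)"
  unfolding tangent_coord_def inv_stereo_def cmod_power2
  by (simp add: inner_complex_def inner_prod_def power2_eq_square algebra_simps)

lemma tangent_coord_inv_stereo: "tangent_coord w (inv_stereo w) = 0"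
  unfolding tangent_coord_def inv_stereo_def cmod_power2
  by (simp add: complex_eq_iff power2_eq_square algebra_simps)

lemma tangent_coord_conformal:
  assumes "inv_stereo w \<bullet> y1 = 0"
  shows "tangent_coord w y1 \<bullet> tangent_coord w y2 = (1 + (cmod w)\<^sup>2)\<^sup>2 * (y1 \<bullet> y2)"
  using assms by (simp add: tangent_coord_inner)

lemma tangent_coord_eq_0_iff:
  assumes "inv_stereo w \<bullet> y = 0"
  shows "tangent_coord w y = 0 \<longleftrightarrow> y = 0"
proof
  assume "tangent_coord w y = 0"
  then have "(1 + (cmod w)\<^sup>2)\<^sup>2 * (y \<bullet> y) = 0"
    using tangent_coord_conformal[OF assms, of y] by simp
  moreover have "1 + (cmod w)\<^sup>2 > 0" by (simp add: add_pos_nonneg)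
  ultimately show "y = 0" by simp
qed (simp add: tangent_coord_def)

section \<open>Geodesics from position and velocity\<close>

text \<open>The backward ideal endpoint \<open>- \<mu>\<^sub>1\<close> and the forward one \<open>1 / cnj \<mu>\<^sub>2\<close>, expressed by
  the point \<open>(z, t)\<close> and the stereographic coordinate \<open>w\<close> of the velocity \<open>(v, s)\<close>. The coordinate
  turns the semicircle geometry into \<open>w = (P / m) (\<bar>m\<bar> / \<bar>P\<bar>) e\<^sup>r\<close>, where \<open>m = cnj \<mu>\<^sub>2\<close>
  and \<open>P = 1 + \<mu>\<^sub>1 m\<close>. Multiplying out the denominator in the formula for \<open>\<mu>\<^sub>2\<close> makes it hold
  for vertical geodesics as well.\<close>

lemma geodesic_coords:
  assumes LH: "(\<mu>1, \<mu>2) \<in> LH3_coords"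
    and pt: "oriented_geodesic (\<mu>1, \<mu>2) r = (z, t)"
    and vel: "(oriented_geodesic (\<mu>1, \<mu>2) has_vector_derivative (v, s)) (at r)"
  defines "w \<equiv> v / complex_of_real (t + s)"
  shows "t + s > 0" "\<mu>1 = of_real t * w - z" "\<mu>2 * (of_real t + cnj z * w) = w"
    "of_real t + cnj z * w \<noteq> 0"
proof -
  have "t + s > 0 \<and> \<mu>1 = of_real t * w - z \<and> \<mu>2 * (of_real t + cnj z * w) = w
     \<and> of_real t + cnj z * w \<noteq> 0"
  proof (cases "\<mu>2 = 0")
    case True
    have zt: "z = - \<mu>1" "t = exp r" using pt True by (auto simp: oriented_geodesic_def)
    have "((\<lambda>r. (- \<mu>1, exp r)) has_vector_derivative (0, exp r)) (at r)"
      by (auto intro!: derivative_eq_intros has_vector_derivative_Pair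
          simp flip: has_real_derivative_iff_has_vector_derivative)
    with vel True have "(v, s) = (0, exp r)"
      by (intro vector_derivative_unique_at[of "\<lambda>r. (- \<mu>1, exp r)" "(v, s)" r])
        (simp_all add: oriented_geodesic_def)
    then show ?thesis using zt True by (simp add: w_def)
  next
    case False
    define m P where "m = cnj \<mu>2" and "P = 1 + \<mu>1 * m"
    have m: "m \<noteq> 0" using False by (simp add: m_def)
    have P: "P \<noteq> 0" using LH by (auto simp: LH3_coords_def P_def m_def add_eq_0_iff)
    define k where "k = cmod P / cmod m"
    have k: "k > 0" using m P by (simp add: k_def)
    have geo: "oriented_geodesic (\<mu>1, \<mu>2) =
      (\<lambda>r. ((2 - P) / (2 * m) + P / (2 * m) * of_real (tanh r), k / (2 * cosh r)))"
    proof -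
      have "cmod (1 + cnj \<mu>1 * \<mu>2) = cmod P"
        unfolding P_def m_def by (metis complex_cnj_add complex_cnj_cnj complex_cnj_mult complex_cnj_one complex_mod_cnj)
      then show ?thesis using False
        by (auto simp: oriented_geodesic_def fun_eq_iff P_def m_def k_def field_simps)
    qed
    have z: "z = (2 - P) / (2 * m) + P / (2 * m) * of_real (tanh r)" and t: "t = k / (2 * cosh r)"
      using pt by (auto simp: geo)
    have d1: "((\<lambda>r. (2 - P) / (2 * m) + P / (2 * m) * complex_of_real (tanh r)) has_vector_derivative
         P / (2 * m) * of_real (1 - (tanh r)\<^sup>2)) (at r)"
      using cosh_real_pos[of r]
      by (auto intro!: derivative_eq_intros)
    have d2: "((\<lambda>r. k / (2 * cosh r)) has_vector_derivative - (k * sinh r / (2 * (cosh r)\<^sup>2))) (at r)"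
      using cosh_real_pos[of r] unfolding has_real_derivative_iff_has_vector_derivative[symmetric]
      by (auto intro!: derivative_eq_intros simp: power2_eq_square)
    have vs: "v = P / (2 * m) * of_real (1 - (tanh r)\<^sup>2)" "s = - (k * sinh r / (2 * (cosh r)\<^sup>2))"
      using vector_derivative_unique_at[OF vel[unfolded geo] has_vector_derivative_Pair[OF d1 d2]]
      by auto
    have ch: "cosh r > 0" by simp
    have e: "exp r = cosh r + sinh r" "exp (-r) = cosh r - sinh r"
      by (simp_all add: sinh_def cosh_def field_simps)
    have pyth: "(cosh r)\<^sup>2 - (sinh r)\<^sup>2 = 1" by (simp add: hyperbolic_pythagoras)
    have ee: "exp r * exp (-r) = 1" by (simp flip: exp_add)
    have ts: "t + s = k * exp (-r) / (2 * (cosh r)\<^sup>2)"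
      using ch unfolding t vs e by (simp add: field_simps power2_eq_square)
    have th: "1 - (tanh r)\<^sup>2 = 1 / (cosh r)\<^sup>2"
    proof -
      have "1 - (tanh r)\<^sup>2 = ((cosh r)\<^sup>2 - (sinh r)\<^sup>2) / (cosh r)\<^sup>2"
        using ch by (simp add: tanh_def power_divide diff_divide_distrib)
      then show ?thesis by (simp add: pyth)
    qed
    have w: "w = of_real (exp r / k) * (P / m)"
    proof -
      have eq: "(1 / (2 * (cosh r)\<^sup>2)) / (k * exp (-r) / (2 * (cosh r)\<^sup>2)) = exp r / k"
        using ch k ee by (simp add: exp_minus field_simps)
      have "w = (P / (2 * m) * of_real (1 / (cosh r)\<^sup>2)) / of_real (k * exp (-r) / (2 * (cosh r)\<^sup>2))"
        unfolding w_def ts unfolding vs(1) th ..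
      also have "\<dots> = (P / m) * of_real ((1 / (2 * (cosh r)\<^sup>2)) / (k * exp (-r) / (2 * (cosh r)\<^sup>2)))"
        by (simp del: of_real_exp)
      also note eq
      finally show ?thesis by (simp add: mult.commute)
    qed
    have tw: "of_real t * w = P / (2 * m) * of_real (1 + tanh r)"
    proof -
      have "of_real t * w = (P / (2*m)) * of_real (exp r / cosh r)"
        unfolding t w using k ch by (simp add: mult_ac)
      also have "exp r / cosh r = 1 + tanh r" using ch by (simp add: e tanh_def field_simps)
      finally show ?thesis .
    qed
    have mu1: "\<mu>1 = of_real t * w - z"
      unfolding tw z using m by (simp add: P_def field_simps)
    have kk: "of_real (k\<^sup>2) * (m * cnj m) = P * cnj P"
      using m unfolding complex_norm_square[symmetric] k_def by (simp add: power_divide)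
    have Pm: "P * cnj w = of_real (k * exp r) * m"
    proof -
      have "P * cnj w = of_real (exp r / k) * (P * cnj P) / cnj m" by (simp add: w)
      also have "\<dots> = of_real (exp r / k * k\<^sup>2) * m" unfolding kk[symmetric] using m by simp
      finally show ?thesis using k by (simp add: power2_eq_square mult.commute)
    qed
    have tq: "of_real t * (1 + w * cnj w) = complex_of_real (k * exp r)"
    proof -
      have "w * cnj w = of_real ((exp r / k)\<^sup>2) * ((P * cnj P) / (m * cnj m))"
        by (simp add: w power2_eq_square mult_ac)
      also have "\<dots> = of_real ((exp r)\<^sup>2)"
        using k m unfolding kk[symmetric] by (simp add: power_divide)
      finally have "of_real t * (1 + w * cnj w) = complex_of_real (t * (1 + (exp r)\<^sup>2))" by simp
      also have "1 + (exp r)\<^sup>2 = 2 * cosh r * exp r"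
        using ee by (simp add: e power2_eq_square algebra_simps)
      finally show ?thesis using ch by (simp add: t)
    qed
    have mD: "m * (of_real t + z * cnj w) = cnj w"
    proof -
      have z': "z = of_real t * w - \<mu>1" using mu1 by simp
      have "m * (of_real t + z * cnj w) = m * (of_real t * (1 + w * cnj w)) - (P - 1) * cnj w"
        unfolding z' by (simp add: P_def algebra_simps)
      also have "\<dots> = cnj w" unfolding tq using Pm by (simp add: algebra_simps)
      finally show ?thesis .
    qed
    have "\<mu>2 * (of_real t + cnj z * w) = w"
      using arg_cong[OF mD, of cnj] by (simp add: m_def)
    moreover have "w \<noteq> 0" using k P m by (simp add: w)
    moreover have "t + s > 0" using ts k ch by simp
    ultimately show ?thesis using mu1 by auto
  qed
  then show "t + s > 0" "\<mu>1 = of_real t * w - z" "\<mu>2 * (of_real t + cnj z * w) = w"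
    "of_real t + cnj z * w \<noteq> 0" by blast+
qed

section \<open>The normal and the shape operator of a surface patch\<close>

text \<open>The cross product of \<open>\<real>\<^sup>3\<close>, transported to \<open>\<complex> \<times> \<real>\<close>.\<close>

definition cross :: "pt3 \<Rightarrow> pt3 \<Rightarrow> pt3" where
  "cross a b = (- \<i> * (snd b *\<^sub>R fst a - snd a *\<^sub>R fst b), Im (cnj (fst a) * fst b))"

lemma bounded_bilinear_cross: "bounded_bilinear cross"
  unfolding bilinear_conv_bounded_bilinear[symmetric] bilinear_def
  by (intro conjI allI linearI)
    (simp_all add: cross_def algebra_simps scaleR_conv_of_real)

lemma orthogonal_imp_parallel_cross:
  assumes "y \<bullet> a = 0" "y \<bullet> b = 0"
  shows "(cross a b \<bullet> cross a b) *\<^sub>R y = (y \<bullet> cross a b) *\<^sub>R cross a b"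
proof -
  obtain y1 y2 y3 a1 a2 a3 b1 b2 b3 where
    eq: "y = (Complex y1 y2, y3)" "a = (Complex a1 a2, a3)" "b = (Complex b1 b2, b3)"
    by (metis complex.exhaust prod.exhaust)
  have h: "y1 * a1 + y2 * a2 + y3 * a3 = 0" "y1 * b1 + y2 * b2 + y3 * b3 = 0"
    using assms by (simp_all add: eq inner_complex_def)
  define c1 c2 c3 where c: "c1 = a2 * b3 - a3 * b2" "c2 = a3 * b1 - a1 * b3" "c3 = a1 * b2 - a2 * b1"
  have C: "cross a b = (Complex c1 c2, c3)"
    by (simp add: cross_def eq c complex_eq_iff algebra_simps)
  have "(c1*c1 + c2*c2 + c3*c3) * y1 = (y1*c1 + y2*c2 + y3*c3) * c1"
       "(c1*c1 + c2*c2 + c3*c3) * y2 = (y1*c1 + y2*c2 + y3*c3) * c2"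
       "(c1*c1 + c2*c2 + c3*c3) * y3 = (y1*c1 + y2*c2 + y3*c3) * c3"
    using h unfolding c by algebra+
  then show ?thesis
    by (simp add: C) (simp add: eq inner_complex_def complex_eq_iff)
qed

lemma cross_eq_0_imp_parallel:
  assumes "cross a b = 0"
  shows "(a \<bullet> a) *\<^sub>R b = (a \<bullet> b) *\<^sub>R a"
proof -
  obtain a1 a2 a3 b1 b2 b3 where
    eq: "a = (Complex a1 a2, a3)" "b = (Complex b1 b2, b3)"
    by (metis complex.exhaust prod.exhaust)
  have h: "a2 * b3 - a3 * b2 = 0" "a3 * b1 - a1 * b3 = 0" "a1 * b2 - a2 * b1 = 0"
    using assms by (simp_all add: cross_def eq complex_eq_iff zero_prod_def algebra_simps)
  have "(a1*a1 + a2*a2 + a3*a3) * b1 = (a1*b1 + a2*b2 + a3*b3) * a1"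
       "(a1*a1 + a2*a2 + a3*a3) * b2 = (a1*b1 + a2*b2 + a3*b3) * a2"
       "(a1*a1 + a2*a2 + a3*a3) * b3 = (a1*b1 + a2*b2 + a3*b3) * a3"
    using h by algebra+
  then show ?thesis
    by (simp add: eq inner_complex_def complex_eq_iff)
qed

lemma cross_linear_image_neq_0:
  fixes L :: "real \<times> real \<Rightarrow> pt3"
  assumes "linear L" "inj L"
  shows "cross (L (1, 0)) (L (0, 1)) \<noteq> 0"
proof
  define a b where "a = L (1, 0)" and "b = L (0, 1)"
  assume "cross (L (1, 0)) (L (0, 1)) = 0"
  then have "L ((a \<bullet> a) *\<^sub>R (0, 1)) = L ((a \<bullet> b) *\<^sub>R (1, 0))"
    using cross_eq_0_imp_parallel[of a b] unfolding linear_scale[OF assms(1)] by (simp only: a_def b_def)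
  then have "(a \<bullet> a) *\<^sub>R (0, 1) = (a \<bullet> b) *\<^sub>R (1::real, 0::real)"
    using assms(2) by (rule injD[rotated])
  then have "a = 0" by simp
  then have "L (1, 0) = L 0" using linear_0[OF assms(1)] by (simp add: a_def)
  then have "(1::real, 0::real) = 0" using assms(2) by (rule injD[rotated])
  then show False by (simp add: zero_prod_def)
qed

locale surface_patch =
  fixes D :: "(real \<times> real) set" and x n :: "real \<times> real \<Rightarrow> pt3"
  assumes open_D: "open D"
    and C2: "C2_on x D"
    and in_H3: "\<And>u. u \<in> D \<Longrightarrow> x u \<in> H3"
    and immersion: "\<And>u. u \<in> D \<Longrightarrow> inj (frechet_derivative x (at u))"
    and cont_n: "continuous_on D n"
    and unit: "\<And>u. u \<in> D \<Longrightarrow> hyp_metric (x u) (n u) (n u) = 1"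
    and normal: "\<And>u w. u \<in> D \<Longrightarrow> hyp_metric (x u) (n u) (frechet_derivative x (at u) w) = 0"
begin

abbreviation dx where "dx u \<equiv> frechet_derivative x (at u)"
abbreviation dn where "dn u \<equiv> frechet_derivative n (at u)"

lemma height_pos: "u \<in> D \<Longrightarrow> snd (x u) > 0"
  using in_H3 by (simp add: H3_def)

lemma n_unit: "u \<in> D \<Longrightarrow> n u \<bullet> n u = (snd (x u))\<^sup>2"
  using unit[of u] height_pos[of u] by (simp add: hyp_metric_def)

lemma n_normal: "u \<in> D \<Longrightarrow> n u \<bullet> dx u w = 0"
  using normal[of u w] height_pos[of u] by (simp add: hyp_metric_def)

text \<open>Bundles the definition of \<open>C\<^sup>2\<close> into partial derivatives \<open>v \<mapsto> dx v w\<close> with a fixed direction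
  \<open>w\<close>, which are maps between Euclidean spaces.\<close>

lemma obtain_second_derivative:
  obtains x' x'' where "\<And>u. u \<in> D \<Longrightarrow> (x has_derivative blinfun_apply (x' u)) (at u)"
    "\<And>u. u \<in> D \<Longrightarrow> dx u = blinfun_apply (x' u)"
    "\<And>u w. u \<in> D \<Longrightarrow> ((\<lambda>v. blinfun_apply (x' v) w) has_derivative x'' u w) (at u)"
proof -
  obtain x' where x': "\<And>u. u \<in> D \<Longrightarrow> (x has_derivative blinfun_apply (x' u)) (at u)" "C1_on x' D"
    using C2 unfolding C2_on_def by blast
  obtain F where F: "\<And>u. u \<in> D \<Longrightarrow> (x' has_derivative blinfun_apply (F u)) (at u)"
    using x'(2) unfolding C1_on_def by blast
  have "((\<lambda>v. blinfun_apply (x' v) w) has_derivative (\<lambda>h. blinfun_apply (blinfun_apply (F u) h) w)) (at u)"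
    if "u \<in> D" for u w
    by (rule bounded_linear.has_derivative[OF blinfun.bounded_linear_left F[OF that]])
  then show ?thesis
    using that[of x' "\<lambda>u w h. blinfun_apply (blinfun_apply (F u) h) w"] x'(1)
      frechet_derivative_at[OF x'(1), symmetric] by blast
qed

lemma dx_has_derivative: "u \<in> D \<Longrightarrow> (x has_derivative dx u) (at u)"
  by (rule obtain_second_derivative) simp

lemma linear_dx: "u \<in> D \<Longrightarrow> linear (dx u)"
  using dx_has_derivative has_derivative_linear by blast

text \<open>The normal is \<open>\<sigma> t C / \<bar>C\<bar>\<close> with \<open>C\<close> the cross product of the partial derivatives, which is
  differentiable, and \<open>\<sigma> = \<plusminus>1\<close>. Continuity of \<open>n\<close> makes \<open>\<sigma>\<close> locally constant.\<close>

lemma n_differentiable: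
  assumes u: "u \<in> D"
  shows "n differentiable (at u)"
proof -
  obtain x' x'' where x': "\<And>u. u \<in> D \<Longrightarrow> (x has_derivative blinfun_apply (x' u)) (at u)"
    "\<And>u. u \<in> D \<Longrightarrow> dx u = blinfun_apply (x' u)"
    "\<And>u w. u \<in> D \<Longrightarrow> ((\<lambda>v. blinfun_apply (x' v) w) has_derivative x'' u w) (at u)"
    using obtain_second_derivative by blast
  define C where "C v = cross (blinfun_apply (x' v) (1, 0)) (blinfun_apply (x' v) (0, 1))" for v
  have C0: "C v \<noteq> 0" if "v \<in> D" for v
    using cross_linear_image_neq_0[OF linear_dx[OF that] immersion[OF that]] x'(2)[OF that]
    by (simp add: C_def)
  have dC: "C differentiable (at v)" if "v \<in> D" for v
    unfolding C_def differentiable_def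
    using bounded_bilinear.FDERIV[OF bounded_bilinear_cross x'(3)[OF that] x'(3)[OF that]] by blast
  have dx3: "(\<lambda>v. snd (x v)) differentiable (at v)" if "v \<in> D" for v
    using x'(1)[OF that] unfolding differentiable_def by (blast intro: has_derivative_snd)
  have dnC: "(\<lambda>v. norm (C v)) differentiable (at v)" if "v \<in> D" for v
    by (rule differentiable_compose[of norm C]) (use C0 dC that differentiable_norm_at in blast)+
  define \<sigma> where "\<sigma> v = (n v \<bullet> C v) / (snd (x v) * norm (C v))" for v
  have par: "(norm (C v))\<^sup>2 *\<^sub>R n v = (n v \<bullet> C v) *\<^sub>R C v" if "v \<in> D" for v
    using orthogonal_imp_parallel_cross[of "n v" "blinfun_apply (x' v) (1, 0)" "blinfun_apply (x' v) (0, 1)"]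
      n_normal[OF that] x'(2)[OF that] by (simp add: C_def power2_norm_eq_inner)
  have n_eq: "n v = (\<sigma> v * snd (x v) / norm (C v)) *\<^sub>R C v" if v: "v \<in> D" for v
  proof -
    have "n v = (1 / (norm (C v))\<^sup>2) *\<^sub>R ((norm (C v))\<^sup>2 *\<^sub>R n v)" using C0[OF v] by simp
    also have "\<dots> = (\<sigma> v * snd (x v) / norm (C v)) *\<^sub>R C v"
      unfolding par[OF v] using C0[OF v] height_pos[OF v] by (simp add: \<sigma>_def power2_eq_square)
    finally show ?thesis .
  qed
  have \<sigma>_values: "\<sigma> v = 1 \<or> \<sigma> v = - 1" if v: "v \<in> D" for v
  proof -
    have "(snd (x v))\<^sup>2 = (\<sigma> v)\<^sup>2 * (snd (x v))\<^sup>2"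
      using n_unit[OF v] C0[OF v] arg_cong[OF n_eq[OF v], of "\<lambda>y. y \<bullet> y"]
      by (simp add: power2_eq_square dot_square_norm)
    then show ?thesis using height_pos[OF v] by (simp add: power2_eq_1_iff)
  qed
  have diff_cont: "continuous_on D h" if "\<And>v. v \<in> D \<Longrightarrow> h differentiable (at v)"
    for h :: "real \<times> real \<Rightarrow> 'c::real_normed_vector"
    using that by (blast intro: continuous_at_imp_continuous_on differentiable_imp_continuous_within)
  have cont\<sigma>: "continuous_on D \<sigma>"
    unfolding \<sigma>_def
    apply (intro continuous_on_divide continuous_on_inner continuous_on_mult cont_n)
    apply (rule diff_cont, rule dC, assumption)
    apply (rule diff_cont, rule dx3, assumption)
    apply (rule diff_cont, rule dnC, assumption)
    apply (rule ballI)
    subgoal for v using C0[of v] height_pos[of v] by simp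
    done
  define D' where "D' = {v \<in> D. \<sigma> v \<in> ball (\<sigma> u) 1}"
  have "open D'"
  proof -
    have "D' = D \<inter> \<sigma> -` ball (\<sigma> u) 1" by (auto simp: D'_def)
    then show ?thesis using continuous_open_preimage[OF cont\<sigma> open_D open_ball] by simp
  qed
  have uD': "u \<in> D'" using u by (simp add: D'_def)
  have n_eq': "(\<sigma> u * snd (x v) / norm (C v)) *\<^sub>R C v = n v" if v: "v \<in> D'" for v
  proof -
    have "v \<in> D" "\<bar>\<sigma> u - \<sigma> v\<bar> < 1" using v by (simp_all add: D'_def dist_real_def)
    then have "\<sigma> v = \<sigma> u" using \<sigma>_values[of v] \<sigma>_values[OF u] by linarith
    then show ?thesis using n_eq[OF \<open>v \<in> D\<close>] by simp
  qed
  have "(\<lambda>v. (\<sigma> u * snd (x v) / norm (C v)) *\<^sub>R C v) differentiable (at u)"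
    by (intro differentiable_scaleR differentiable_divide differentiable_mult differentiable_const
        dC[OF u] dx3[OF u] dnC[OF u]) (simp add: C0[OF u])
  then obtain n' where "((\<lambda>v. (\<sigma> u * snd (x v) / norm (C v)) *\<^sub>R C v) has_derivative n') (at u)"
    unfolding differentiable_def by blast
  then have "(n has_derivative n') (at u)"
    by (rule has_derivative_transform_within_open[OF _ \<open>open D'\<close> uD' n_eq'])
  then show ?thesis unfolding differentiable_def by blast
qed

lemma dn_has_derivative: "u \<in> D \<Longrightarrow> (n has_derivative dn u) (at u)"
  using n_differentiable frechet_derivative_works by blast

lemma linear_dn: "u \<in> D \<Longrightarrow> linear (dn u)"
  using dn_has_derivative has_derivative_linear by blast

text \<open>Differentiating \<open>\<langle>n, dx(w)\<rangle> = 0\<close> turns \<open>\<langle>dx(w), dn(h)\<rangle>\<close> into the second fundamental form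
  \<open>- \<langle>n, D\<^sup>2x(w, h)\<rangle>\<close>.\<close>

lemma dx_dn_symmetric:
  assumes u: "u \<in> D"
  shows "dx u w1 \<bullet> dn u w2 = dx u w2 \<bullet> dn u w1"
proof -
  obtain x' x'' where x': "\<And>u. u \<in> D \<Longrightarrow> (x has_derivative blinfun_apply (x' u)) (at u)"
    "\<And>u. u \<in> D \<Longrightarrow> dx u = blinfun_apply (x' u)"
    "\<And>u w. u \<in> D \<Longrightarrow> ((\<lambda>v. blinfun_apply (x' v) w) has_derivative x'' u w) (at u)"
    using obtain_second_derivative by blast
  have weingarten: "dx u w \<bullet> dn u h = - (n u \<bullet> x'' u w h)" for w h
  proof -
    have "((\<lambda>v. n v \<bullet> blinfun_apply (x' v) w) has_derivative
        (\<lambda>h. n u \<bullet> x'' u w h + dn u h \<bullet> blinfun_apply (x' u) w)) (at u)"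
      by (rule has_derivative_inner[OF dn_has_derivative[OF u] x'(3)[OF u]])
    moreover have "((\<lambda>v. n v \<bullet> blinfun_apply (x' v) w) has_derivative (\<lambda>h. 0)) (at u)"
      by (rule has_derivative_transform_within_open[OF has_derivative_const open_D u])
        (simp add: n_normal flip: x'(2))
    ultimately have "(\<lambda>h. n u \<bullet> x'' u w h + dn u h \<bullet> blinfun_apply (x' u) w) = (\<lambda>h. 0)"
      by (rule has_derivative_unique)
    from fun_cong[OF this, of h] show ?thesis using x'(2)[OF u] by (simp add: inner_commute)
  qed
  have "n u \<bullet> x'' u w1 w2 = n u \<bullet> x'' u w2 w1"
    by (rule second_derivative_symmetric[OF open_D u, of "\<lambda>y. n u \<bullet> x y"
          "\<lambda>y h. n u \<bullet> blinfun_apply (x' y) h" w1 "\<lambda>h. n u \<bullet> x'' u w1 h" w2 "\<lambda>h. n u \<bullet> x'' u w2 h"])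
      (auto intro!: has_derivative_inner_right x'(1,3) u)
  then show ?thesis by (simp add: weingarten)
qed

lemma n_dn:
  assumes u: "u \<in> D"
  shows "n u \<bullet> dn u w = snd (x u) * snd (dx u w)"
proof -
  have "((\<lambda>v. n v \<bullet> n v) has_derivative (\<lambda>h. n u \<bullet> dn u h + dn u h \<bullet> n u)) (at u)"
    by (rule has_derivative_inner[OF dn_has_derivative[OF u] dn_has_derivative[OF u]])
  moreover have "((\<lambda>v. (snd (x v))\<^sup>2) has_derivative (\<lambda>h. 2 * (snd (x u) * snd (dx u h)))) (at u)"
    by (auto intro!: derivative_eq_intros dx_has_derivative[OF u])
  then have "((\<lambda>v. n v \<bullet> n v) has_derivative (\<lambda>h. 2 * (snd (x u) * snd (dx u h)))) (at u)"
    by (rule has_derivative_transform_within_open[OF _ open_D u]) (simp add: n_unit)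
  ultimately have "(\<lambda>h. n u \<bullet> dn u h + dn u h \<bullet> n u) = (\<lambda>h. 2 * (snd (x u) * snd (dx u h)))"
    by (rule has_derivative_unique)
  from fun_cong[OF this, of w] show ?thesis by (simp add: inner_commute)
qed

lemma cov_deriv_eq:
  assumes u: "u \<in> D"
  shows "cov_deriv x n u w
    = dn u w - (1 / snd (x u)) *\<^sub>R (snd (dx u w) *\<^sub>R n u + snd (n u) *\<^sub>R dx u w)"
  using n_normal[OF u, of w]
  by (simp add: cov_deriv_def hyp_christoffel_def inner_commute zero_prod_def[symmetric])

lemma linear_cov_deriv: "u \<in> D \<Longrightarrow> linear (cov_deriv x n u)"
  using linear_dx[of u] linear_dn[of u]
  by (intro linearI) (simp_all add: cov_deriv_eq linear_add linear_scale algebra_simps)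

lemma cov_deriv_tangential:
  assumes u: "u \<in> D"
  shows "n u \<bullet> cov_deriv x n u w = 0"
  using height_pos[OF u]
  by (simp add: cov_deriv_eq[OF u] inner_diff_right inner_add_right n_dn[OF u] n_unit[OF u]
      n_normal[OF u] power2_eq_square)

text \<open>The covariant derivative of \<open>n\<close> differs from \<open>dn\<close> only by a normal part and a multiple of \<open>dx\<close>, neither of
  which disturbs the symmetry.\<close>

lemma shape_operator_symmetric:
  assumes u: "u \<in> D"
  shows "dx u w1 \<bullet> cov_deriv x n u w2 = dx u w2 \<bullet> cov_deriv x n u w1"
proof -
  have "dx u w \<bullet> n u = 0" for w using n_normal[OF u] by (simp add: inner_commute)
  then show ?thesis
    by (simp add: cov_deriv_eq[OF u] inner_diff_right inner_add_right
        dx_dn_symmetric[OF u, of w1 w2] inner_commute[of "dx u w1" "dx u w2"])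
qed

end

section \<open>Gauss curvature in the stereographic coordinate\<close>

context surface_patch
begin

definition stereo where "stereo v = fst (n v) / complex_of_real (snd (x v) + snd (n v))"

abbreviation dx_coord where "dx_coord u h \<equiv> tangent_coord (stereo u) (dx u h)"

context
  fixes u assumes u: "u \<in> D" and pos: "snd (x u) + snd (n u) > 0"
begin

text \<open>The direction of \<open>n\<close> is recovered from its stereographic coordinate; the Euclidean length of \<open>n\<close>
  is \<open>t\<close>.\<close>

lemma n_eq_inv_stereo:
  "(1 + (cmod (stereo u))\<^sup>2) *\<^sub>R n u = snd (x u) *\<^sub>R inv_stereo (stereo u)"
proof -
  define t s where "t = snd (x u)" and "s = snd (n u)"
  have unit: "(cmod (fst (n u)))\<^sup>2 + s\<^sup>2 = t\<^sup>2"
    using n_unit[OF u] by (simp add: inner_prod_def dot_square_norm s_def t_def power2_eq_square)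
  have q: "(cmod (stereo u))\<^sup>2 = (t - s) / (t + s)"
  proof -
    have "(cmod (stereo u))\<^sup>2 = (cmod (fst (n u)))\<^sup>2 / (t + s)\<^sup>2"
      unfolding stereo_def norm_divide norm_of_real power_divide by (simp add: t_def s_def)
    also have "(cmod (fst (n u)))\<^sup>2 = (t - s) * (t + s)" using unit by (simp add: power2_eq_square algebra_simps)
    finally show ?thesis using pos by (simp add: t_def s_def power2_eq_square)
  qed
  have ts: "t + s > 0" using pos by (simp add: t_def s_def)
  have 1: "1 + (cmod (stereo u))\<^sup>2 = 2 * t / (t + s)" "1 - (cmod (stereo u))\<^sup>2 = 2 * s / (t + s)"
    using ts unfolding q by (simp_all add: field_simps)
  have "(2 * t / (t + s)) *\<^sub>R fst (n u) = t *\<^sub>R (2 * stereo u)"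
    using ts by (simp add: stereo_def scaleR_conv_of_real t_def s_def)
  moreover have "(2 * t / (t + s)) * s = t * (2 * s / (t + s))" by simp
  ultimately show ?thesis
    unfolding 1 inv_stereo_def by (intro prod_eqI) (simp_all flip: t_def s_def add: 1)
qed

lemma q_pos: "1 + (cmod (stereo u))\<^sup>2 > 0"
  by (simp add: add_pos_nonneg)

lemma tangential_iff: "inv_stereo (stereo u) \<bullet> y = 0 \<longleftrightarrow> n u \<bullet> y = 0"
proof -
  have "(1 + (cmod (stereo u))\<^sup>2) * (n u \<bullet> y) = snd (x u) * (inv_stereo (stereo u) \<bullet> y)"
    using arg_cong[OF n_eq_inv_stereo, of "\<lambda>v. v \<bullet> y"] by simp
  then show ?thesis using q_pos height_pos[OF u] by (metis less_irrefl mult_eq_0_iff)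
qed

lemma linear_dx_coord: "linear (dx_coord u)"
  using linear_compose[OF linear_dx[OF u] linear_tangent_coord] by (simp add: o_def)

lemma linear_tangent_coord_cov_deriv: "linear (\<lambda>h. tangent_coord (stereo u) (cov_deriv x n u h))"
  using linear_compose[OF linear_cov_deriv[OF u] linear_tangent_coord] by (simp add: o_def)

text \<open>Immersed means that \<open>dx\<close> is injective, and \<open>tangent_coord\<close> has only normal vectors in its kernel.\<close>

lemma inj_dx_coord: "inj (dx_coord u)"
  unfolding linear_injective_0[OF linear_dx_coord]
  using tangent_coord_eq_0_iff tangential_iff n_normal[OF u] immersion[OF u] linear_injective_0[OF linear_dx[OF u]]
  by blast

lemma surj_dx_coord: "surj (dx_coord u)"
  by (rule linear_injective_imp_surjective[OF linear_dx_coord inj_dx_coord]) simp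

lemma metric_dx_coord:
  "hyp_metric (x u) (dx u h) (dx u h')
    = (dx_coord u h \<bullet> dx_coord u h') / ((1 + (cmod (stereo u))\<^sup>2) * snd (x u))\<^sup>2"
  using tangent_coord_conformal[of "stereo u" "dx u h" "dx u h'"] n_normal[OF u] q_pos
  by (simp add: tangential_iff hyp_metric_def power_mult_distrib)

context
  fixes p b :: complex
  assumes shape: "\<And>h. - tangent_coord (stereo u) (cov_deriv x n u h) = p * dx_coord u h + b * cnj (dx_coord u h)"
begin

text \<open>\<open>Im p\<close> is the coefficient of the skew-symmetric part of \<open>\<zeta> \<mapsto> p \<zeta> + b cnj \<zeta>\<close>.\<close>

lemma shape_coefficient_real: "Im p = 0"
proof -
  have sym: "dx_coord u h \<bullet> (p * dx_coord u h' + b * cnj (dx_coord u h'))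
      = dx_coord u h' \<bullet> (p * dx_coord u h + b * cnj (dx_coord u h))" for h h'
    unfolding shape[symmetric] inner_minus_right
    using shape_operator_symmetric[OF u, of h h'] n_normal[OF u]
    by (simp add: tangent_coord_conformal tangential_iff)
  obtain h h' where h: "dx_coord u h = 1" "dx_coord u h' = \<i>"
    using surjD[OF surj_dx_coord, of 1] surjD[OF surj_dx_coord, of \<i>] by metis
  show ?thesis using sym[of h h'] unfolding h by (simp add: inner_complex_def)
qed

text \<open>The tangent coordinate is a similarity of ratio \<open>(1 + \<bar>w\<bar>\<^sup>2) t\<close> for the hyperbolic metric, so
  principal directions correspond to orthogonal eigenvectors of that common length in \<open>\<complex>\<close>.\<close>

lemma principal_curvatures_iff:
  "principal_curvatures x n u k1 k2 \<longleftrightarrow>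
    (\<exists>\<zeta>1 \<zeta>2. cmod \<zeta>1 = (1 + (cmod (stereo u))\<^sup>2) * snd (x u) \<and> cmod \<zeta>2 = (1 + (cmod (stereo u))\<^sup>2) * snd (x u)
      \<and> \<zeta>1 \<bullet> \<zeta>2 = 0
      \<and> p * \<zeta>1 + b * cnj \<zeta>1 = of_real k1 * \<zeta>1 \<and> p * \<zeta>2 + b * cnj \<zeta>2 = of_real k2 * \<zeta>2)"
proof -
  define c where "c = (1 + (cmod (stereo u))\<^sup>2) * snd (x u)"
  have c: "c > 0" using q_pos height_pos[OF u] by (simp add: c_def)
  have 1: "hyp_metric (x u) (dx u h) (dx u h) = 1 \<longleftrightarrow> cmod (dx_coord u h) = c" for h
    using c unfolding metric_dx_coord c_def[symmetric]
    by (auto simp: dot_square_norm)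
  have 2: "hyp_metric (x u) (dx u h) (dx u h') = 0 \<longleftrightarrow> dx_coord u h \<bullet> dx_coord u h' = 0" for h h'
    using c unfolding metric_dx_coord c_def[symmetric] by simp
  have 3: "- cov_deriv x n u h = k *\<^sub>R dx u h
      \<longleftrightarrow> p * dx_coord u h + b * cnj (dx_coord u h) = of_real k * dx_coord u h" for h k
  proof -
    have "- cov_deriv x n u h = k *\<^sub>R dx u h \<longleftrightarrow> - cov_deriv x n u h - k *\<^sub>R dx u h = 0" by simp
    also have "\<dots> \<longleftrightarrow> tangent_coord (stereo u) (- cov_deriv x n u h - k *\<^sub>R dx u h) = 0"
      by (rule tangent_coord_eq_0_iff[symmetric])
        (unfold tangential_iff, simp add: inner_diff_right n_normal[OF u] cov_deriv_tangential[OF u])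
    also have "\<dots> \<longleftrightarrow> - tangent_coord (stereo u) (cov_deriv x n u h) = of_real k * dx_coord u h"
      by (simp add: linear_diff[OF linear_tangent_coord] linear_neg[OF linear_tangent_coord]
          linear_scale[OF linear_tangent_coord] scaleR_conv_of_real)
    finally show ?thesis unfolding shape .
  qed
  have ex: "(\<exists>w1 w2. Q (dx_coord u w1) (dx_coord u w2)) \<longleftrightarrow> (\<exists>\<zeta>1 \<zeta>2. Q \<zeta>1 \<zeta>2)" for Q
  proof (intro iffI; elim exE)
    fix \<zeta>1 \<zeta>2 assume "Q \<zeta>1 \<zeta>2"
    moreover obtain w1 w2 where "\<zeta>1 = dx_coord u w1" "\<zeta>2 = dx_coord u w2"
      using surjD[OF surj_dx_coord, of \<zeta>1] surjD[OF surj_dx_coord, of \<zeta>2] by blast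
    ultimately show "\<exists>w1 w2. Q (dx_coord u w1) (dx_coord u w2)" by blast
  qed blast
  show ?thesis
    unfolding principal_curvatures_def Let_def 1 2 3 c_def[symmetric]
    by (rule ex[of "\<lambda>\<zeta>1 \<zeta>2. cmod \<zeta>1 = c \<and> cmod \<zeta>2 = c \<and> \<zeta>1 \<bullet> \<zeta>2 = 0
      \<and> p * \<zeta>1 + b * cnj \<zeta>1 = of_real k1 * \<zeta>1 \<and> p * \<zeta>2 + b * cnj \<zeta>2 = of_real k2 * \<zeta>2"])
qed

text \<open>The description by \<open>THE\<close> needs both existence and uniqueness of the product of principal
  curvatures: \<open>antilinear_eigenvector\<close> supplies the eigenvalues \<open>p \<plusminus> \<bar>b\<bar>\<close>, and
  \<open>antilinear_eigenvalue_product\<close> shows that no other product occurs.\<close>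

lemma gauss_curvature_eq: "gauss_curvature x n u = (Re p)\<^sup>2 - (cmod b)\<^sup>2 - 1"
  unfolding gauss_curvature_def
proof (rule the_equality)
  define c where "c = (1 + (cmod (stereo u))\<^sup>2) * snd (x u)"
  have c: "c > 0" using q_pos height_pos[OF u] by (simp add: c_def)
  define r where "r = Re p"
  have p: "p = of_real r" using shape_coefficient_real by (simp add: complex_eq_iff r_def)
  show "\<kappa> = (Re p)\<^sup>2 - (cmod b)\<^sup>2 - 1"
    if \<kappa>: "\<exists>k1 k2. principal_curvatures x n u k1 k2 \<and> \<kappa> = k1 * k2 - 1" for \<kappa>
  proof -
    obtain k1 k2 \<zeta>1 \<zeta>2 where k: "\<kappa> = k1 * k2 - 1" "cmod \<zeta>1 = c" "cmod \<zeta>2 = c" "\<zeta>1 \<bullet> \<zeta>2 = 0"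
      "of_real r * \<zeta>1 + b * cnj \<zeta>1 = of_real k1 * \<zeta>1"
      "of_real r * \<zeta>2 + b * cnj \<zeta>2 = of_real k2 * \<zeta>2"
      using \<kappa> unfolding principal_curvatures_iff c_def[symmetric] p by blast
    have "k1 * k2 = r\<^sup>2 - (cmod b)\<^sup>2"
      by (rule antilinear_eigenvalue_product[OF c k(2-)])
    then show ?thesis by (simp add: k(1) r_def)
  qed
  obtain \<rho> where \<rho>: "cmod \<rho> = 1" "b * cnj \<rho> = of_real (cmod b) * \<rho>"
    by (rule antilinear_eigenvector)
  have e: "of_real r * (of_real c * (\<epsilon> * \<rho>)) + b * cnj (of_real c * (\<epsilon> * \<rho>))
      = of_real c * (of_real r * (\<epsilon> * \<rho>) + cnj \<epsilon> * (b * cnj \<rho>))" for \<epsilon>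
    by (simp add: algebra_simps)
  have "principal_curvatures x n u (Re p + cmod b) (Re p - cmod b)"
    unfolding principal_curvatures_iff c_def[symmetric] r_def[symmetric]
    unfolding p
  proof (intro exI conjI)
    show "cmod (of_real c * (1 * \<rho>)) = c" "cmod (of_real c * (\<i> * \<rho>)) = c"
      using c \<rho> by (simp_all add: norm_mult)
    show "(of_real c * (1 * \<rho>)) \<bullet> (of_real c * (\<i> * \<rho>)) = 0"
      by (simp add: inner_complex_def)
    show "of_real r * (of_real c * (1 * \<rho>)) + b * cnj (of_real c * (1 * \<rho>))
        = of_real (r + cmod b) * (of_real c * (1 * \<rho>))"
      unfolding e \<rho>(2) by (simp add: algebra_simps)
    show "of_real r * (of_real c * (\<i> * \<rho>)) + b * cnj (of_real c * (\<i> * \<rho>))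
        = of_real (r - cmod b) * (of_real c * (\<i> * \<rho>))"
      unfolding e \<rho>(2) by (simp add: algebra_simps)
  qed
  moreover have "(Re p)\<^sup>2 - (cmod b)\<^sup>2 - 1 = (Re p + cmod b) * (Re p - cmod b) - 1"
    by (simp add: power2_eq_square algebra_simps)
  ultimately show "\<exists>k1 k2. principal_curvatures x n u k1 k2 \<and> (Re p)\<^sup>2 - (cmod b)\<^sup>2 - 1 = k1 * k2 - 1"
    by blast
qed

end

lemma obtain_shape_coefficients:
  obtains p b where
    "\<And>h. - tangent_coord (stereo u) (cov_deriv x n u h) = p * dx_coord u h + b * cnj (dx_coord u h)"
proof -
  obtain g where g: "linear g" "g \<circ> dx_coord u = id"
    using linear_injective_left_inverse[OF linear_dx_coord inj_dx_coord] by blast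
  have "linear (\<lambda>\<zeta>. - tangent_coord (stereo u) (cov_deriv x n u (g \<zeta>)))"
    using linear_compose[OF g(1) linear_tangent_coord_cov_deriv] by (simp add: o_def linear_compose_neg)
  then obtain p b where "\<And>\<zeta>. - tangent_coord (stereo u) (cov_deriv x n u (g \<zeta>)) = p * \<zeta> + b * cnj \<zeta>"
    by (rule real_linear_complex_decomposition) blast
  then have "- tangent_coord (stereo u) (cov_deriv x n u h) = p * dx_coord u h + b * cnj (dx_coord u h)" for h
    using g(2) by (metis comp_apply id_apply)
  then show ?thesis by (rule that)
qed

end

end

section \<open>The normal congruence of a patch\<close>

locale congruence_patch = surface_patch +
  fixes \<mu>1 \<mu>2 :: "real \<times> real \<Rightarrow> complex"
  assumes coords: "\<And>u. u \<in> D \<Longrightarrow> (\<mu>1 u, \<mu>2 u) \<in> LH3_coords"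
    and normal_geodesic: "\<And>u. u \<in> D \<Longrightarrow> \<exists>r. oriented_geodesic (\<mu>1 u, \<mu>2 u) r = x u \<and>
      (oriented_geodesic (\<mu>1 u, \<mu>2 u) has_vector_derivative n u) (at r)"
begin

abbreviation denom where "denom v \<equiv> complex_of_real (snd (x v)) + cnj (fst (x v)) * stereo v"

lemma geodesic_through:
  assumes u: "u \<in> D"
  shows "snd (x u) + snd (n u) > 0"
    and "\<mu>1 u = of_real (snd (x u)) * stereo u - fst (x u)"
    and "\<mu>2 u * denom u = stereo u"
    and "denom u \<noteq> 0"
proof -
  obtain r where "oriented_geodesic (\<mu>1 u, \<mu>2 u) r = (fst (x u), snd (x u))"
    "(oriented_geodesic (\<mu>1 u, \<mu>2 u) has_vector_derivative (fst (n u), snd (n u))) (at r)"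
    using normal_geodesic[OF u] by auto
  note * = geodesic_coords[OF coords[OF u] this, folded stereo_def]
  show "snd (x u) + snd (n u) > 0" "\<mu>1 u = of_real (snd (x u)) * stereo u - fst (x u)"
    "\<mu>2 u * denom u = stereo u" "denom u \<noteq> 0"
    by (fact *)+
qed

context
  fixes u dw assumes u: "u \<in> D" and dw: "(stereo has_derivative dw) (at u)"
begin

lemma \<mu>1_has_derivative:
  "(\<mu>1 has_derivative (\<lambda>h. of_real (snd (x u)) * dw h + of_real (snd (dx u h)) * stereo u - fst (dx u h))) (at u)"
proof -
  have "((\<lambda>v. of_real (snd (x v)) * stereo v - fst (x v)) has_derivative
      (\<lambda>h. of_real (snd (x u)) * dw h + of_real (snd (dx u h)) * stereo u - fst (dx u h))) (at u)"
    by (intro has_derivative_diff has_derivative_mult has_derivative_of_real has_derivative_fst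
        has_derivative_snd dx_has_derivative[OF u] dw)
  then show ?thesis
    by (rule has_derivative_transform_within_open[OF _ open_D u]) (simp add: geodesic_through)
qed

text \<open>Differentiates the product \<open>\<mu>\<^sub>2 (t + cnj z w) = w\<close>. The square of the denominator is kept on
  the left, so that the right-hand side has the same shape as \<open>d\<mu>\<^sub>1\<close>.\<close>

lemma \<mu>2_derivative:
  assumes "(\<mu>2 has_derivative d\<mu>2) (at u)"
  shows "(denom u)\<^sup>2 * d\<mu>2 h
    = of_real (snd (x u)) * dw h - stereo u * of_real (snd (dx u h)) - (stereo u)\<^sup>2 * cnj (fst (dx u h))"
proof -
  have "((\<lambda>v. \<mu>2 v * denom v) has_derivative (\<lambda>h. \<mu>2 u * (of_real (snd (dx u h)) +
      (cnj (fst (x u)) * dw h + cnj (fst (dx u h)) * stereo u)) + d\<mu>2 h * denom u)) (at u)"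
    by (intro has_derivative_mult has_derivative_add has_derivative_of_real has_derivative_cnj
        has_derivative_fst has_derivative_snd dx_has_derivative[OF u] dw assms)
  then have "(stereo has_derivative (\<lambda>h. \<mu>2 u * (of_real (snd (dx u h)) +
      (cnj (fst (x u)) * dw h + cnj (fst (dx u h)) * stereo u)) + d\<mu>2 h * denom u)) (at u)"
    by (rule has_derivative_transform_within_open[OF _ open_D u]) (simp add: geodesic_through)
  then have "dw = (\<lambda>h. \<mu>2 u * (of_real (snd (dx u h)) +
      (cnj (fst (x u)) * dw h + cnj (fst (dx u h)) * stereo u)) + d\<mu>2 h * denom u)"
    using dw has_derivative_unique by blast
  from fun_cong[OF this, of h]
  have 1: "dw h = \<mu>2 u * (of_real (snd (dx u h)) +
      (cnj (fst (x u)) * dw h + cnj (fst (dx u h)) * stereo u)) + d\<mu>2 h * denom u" .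
  have "denom u * dw h = (\<mu>2 u * denom u) * (of_real (snd (dx u h)) +
      (cnj (fst (x u)) * dw h + cnj (fst (dx u h)) * stereo u)) + (denom u)\<^sup>2 * d\<mu>2 h"
    by (subst 1) (simp add: algebra_simps power2_eq_square)
  then show ?thesis
    unfolding geodesic_through(3)[OF u] by (simp add: algebra_simps power2_eq_square)
qed

text \<open>Apply \<open>tangent_coord\<close> to the derivative of \<open>n_eq_inv_stereo\<close>: the terms in which a scalar factor is
  differentiated are normal and vanish, leaving the differential of inverse stereographic projection.\<close>

lemma tangent_coord_dn: "tangent_coord (stereo u) (dn u h) = 2 * of_real (snd (x u)) * dw h"
proof -
  define w where "w = stereo u"
  define dq where "dq = 2 * (w \<bullet> dw h)"
  have norm2: "((\<lambda>v. (cmod (stereo v))\<^sup>2) has_derivative (\<lambda>h. 2 * (w \<bullet> dw h))) (at u)"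
    unfolding power2_norm_eq_inner w_def
    by (rule has_derivative_eq_rhs[OF has_derivative_inner[OF dw dw]]) (simp add: inner_commute)
  have L: "((\<lambda>v. (1 + (cmod (stereo v))\<^sup>2) *\<^sub>R n v) has_derivative
      (\<lambda>h. (1 + (cmod w)\<^sup>2) *\<^sub>R dn u h + (0 + 2 * (w \<bullet> dw h)) *\<^sub>R n u)) (at u)"
    unfolding w_def
    by (intro has_derivative_scaleR has_derivative_add has_derivative_const norm2[unfolded w_def] dn_has_derivative[OF u])
  have inv_stereo: "((\<lambda>v. inv_stereo (stereo v)) has_derivative (\<lambda>h. (2 * dw h, 0 - 2 * (w \<bullet> dw h)))) (at u)"
    unfolding inv_stereo_def
    by (intro has_derivative_Pair has_derivative_diff has_derivative_const norm2 has_derivative_mult_right dw)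
  have R: "((\<lambda>v. snd (x v) *\<^sub>R inv_stereo (stereo v)) has_derivative
      (\<lambda>h. snd (x u) *\<^sub>R (2 * dw h, 0 - 2 * (w \<bullet> dw h)) + snd (dx u h) *\<^sub>R inv_stereo w)) (at u)"
    unfolding w_def
    by (intro has_derivative_scaleR has_derivative_snd dx_has_derivative[OF u] inv_stereo[unfolded w_def])
  have "((\<lambda>v. (1 + (cmod (stereo v))\<^sup>2) *\<^sub>R n v) has_derivative
      (\<lambda>h. snd (x u) *\<^sub>R (2 * dw h, 0 - 2 * (w \<bullet> dw h)) + snd (dx u h) *\<^sub>R inv_stereo w)) (at u)"
    by (rule has_derivative_transform_within_open[OF R open_D u]) (simp add: n_eq_inv_stereo geodesic_through)
  from fun_cong[OF has_derivative_unique[OF L this], of h]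
  have "(1 + (cmod w)\<^sup>2) *\<^sub>R dn u h + dq *\<^sub>R n u
      = snd (x u) *\<^sub>R (2 * dw h, - dq) + snd (dx u h) *\<^sub>R inv_stereo w"
    by (simp add: dq_def)
  from arg_cong[OF this, of "tangent_coord w"]
  have "(1 + (cmod w)\<^sup>2) *\<^sub>R tangent_coord w (dn u h) + dq *\<^sub>R tangent_coord w (n u)
      = snd (x u) *\<^sub>R tangent_coord w (2 * dw h, - dq)"
    unfolding linear_add[OF linear_tangent_coord] linear_scale[OF linear_tangent_coord] tangent_coord_inv_stereo by simp
  moreover have "tangent_coord w (n u) = 0"
    using arg_cong[OF n_eq_inv_stereo[OF u geodesic_through(1)[OF u]], of "tangent_coord w"]
      q_pos[OF u geodesic_through(1)[OF u]]
    by (simp add: linear_scale[OF linear_tangent_coord] tangent_coord_inv_stereo w_def)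
  moreover have "tangent_coord w (2 * dw h, - dq) = (1 + (cmod w)\<^sup>2) *\<^sub>R (2 * dw h)"
  proof -
    have "complex_of_real dq = w * cnj (dw h) + dw h * cnj w"
      by (simp add: dq_def complex_eq_iff inner_complex_def)
    then show ?thesis
      unfolding tangent_coord_def scaleR_conv_of_real of_real_add complex_norm_square
      by (simp add: power2_eq_square algebra_simps)
  qed
  ultimately have "(1 + (cmod w)\<^sup>2) *\<^sub>R tangent_coord w (dn u h)
      = (1 + (cmod w)\<^sup>2) *\<^sub>R (snd (x u) *\<^sub>R (2 * dw h))" by simp
  then show ?thesis
    using q_pos[OF u geodesic_through(1)[OF u]]
    unfolding real_vector.scale_cancel_left by (simp add: w_def scaleR_conv_of_real)
qed

text \<open>Compare \<open>\<mu>1_has_derivative\<close> and \<open>\<mu>2_derivative\<close>: the right-hand side is the sum of \<open>d\<mu>\<^sub>1\<close>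
  and \<open>(t + cnj z w)\<^sup>2 d\<mu>\<^sub>2\<close>, while the difference of the second and the first is
  \<open>tangent_coord w\<close> of \<open>dx\<close> by definition.\<close>

lemma tangent_coord_cov_deriv:
  "tangent_coord (stereo u) (cov_deriv x n u h)
    = 2 * of_real (snd (x u)) * dw h - fst (dx u h) - (stereo u)\<^sup>2 * cnj (fst (dx u h))"
proof -
  define w t s where "w = stereo u" and "t = snd (x u)" and "s = snd (n u)"
  define dz dt where "dz = fst (dx u h)" and "dt = snd (dx u h)"
  define q where "q = (cmod w)\<^sup>2"
  have pos: "t + s > 0" "t > 0"
    using geodesic_through(1)[OF u] height_pos[OF u] by (simp_all add: t_def s_def)
  note inv_stereo = n_eq_inv_stereo[OF u geodesic_through(1)[OF u]]
  have q: "1 + q > 0" using q_pos[OF u geodesic_through(1)[OF u]] by (simp add: q_def w_def)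
  have s: "(1 + q) * s = t * (1 - q)"
    using arg_cong[OF inv_stereo, of snd] by (simp add: q_def w_def s_def t_def inv_stereo_def)
  have Ln: "tangent_coord w (n u) = 0"
    using arg_cong[OF inv_stereo, of "tangent_coord w"] q
    by (simp add: linear_scale[OF linear_tangent_coord] tangent_coord_inv_stereo w_def q_def)
  have T: "inv_stereo w \<bullet> dx u h = 0"
    unfolding w_def tangential_iff[OF u geodesic_through(1)[OF u]] by (rule n_normal[OF u])
  \<comment> \<open>tangency of \<open>dx\<close>; it absorbs the vertical component \<open>dt\<close>\<close>
  have tan: "w * cnj dz + cnj w * dz + (1 - of_real q) * of_real dt = 0"
    using T by (simp add: inv_stereo_def inner_prod_def inner_complex_def complex_eq_iff q_def dz_def dt_def algebra_simps)
  have "tangent_coord w (cov_deriv x n u h) = 2 * of_real t * dw h - of_real (s / t) * tangent_coord w (dx u h)"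
    using tangent_coord_dn[of h] Ln
    by (simp add: cov_deriv_eq[OF u] linear_diff[OF linear_tangent_coord] linear_add[OF linear_tangent_coord]
        linear_scale[OF linear_tangent_coord] scaleR_conv_of_real w_def t_def s_def)
  also have "s / t = (1 - q) / (1 + q)"
    using s pos q by (simp add: field_simps)
  also have "of_real ((1 - q) / (1 + q)) * tangent_coord w (dx u h) = dz + w\<^sup>2 * cnj dz"
  proof -
    have qw: "complex_of_real q = w * cnj w" unfolding q_def by (rule complex_norm_square)
    have "(1 - of_real q) * tangent_coord w (dx u h) - (1 + of_real q) * (dz + w\<^sup>2 * cnj dz)
        = - 2 * w * (w * cnj dz + cnj w * dz + (1 - of_real q) * of_real dt)"
      unfolding tangent_coord_def dz_def[symmetric] dt_def[symmetric] qw
      by (simp add: power2_eq_square algebra_simps)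
    then have "(1 - of_real q) * tangent_coord w (dx u h) = (1 + of_real q) * (dz + w\<^sup>2 * cnj dz)"
      unfolding tan by simp
    moreover have "1 + complex_of_real q \<noteq> 0"
      using q by (metis less_irrefl of_real_1 of_real_add of_real_eq_0_iff)
    ultimately show ?thesis by (simp add: divide_eq_eq mult.commute)
  qed
  finally show ?thesis by (simp add: w_def t_def dz_def)
qed

end

lemma stereo_differentiable:
  assumes u: "u \<in> D"
  obtains dw where "(stereo has_derivative dw) (at u)"
proof -
  have "snd (x u) + snd (n u) \<noteq> 0" using geodesic_through(1)[OF u] by simp
  then have "stereo differentiable (at u)"
    unfolding stereo_def[abs_def] differentiable_def
    using has_derivative_divide[OF has_derivative_fst[OF dn_has_derivative[OF u]]
       has_derivative_of_real[OF has_derivative_add[OF has_derivative_snd[OF dx_has_derivative[OF u]]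
       has_derivative_snd[OF dn_has_derivative[OF u]]]]] of_real_eq_0_iff by blast
  then show ?thesis using that unfolding differentiable_def by blast
qed

text \<open>With \<open>\<zeta>\<close> the tangent coordinate and \<open>M\<close> the shape operator, \<open>M \<zeta> + \<zeta> = - 2 d\<mu>\<^sub>1\<close> and
  \<open>M \<zeta> - \<zeta> = - 2 (t + cnj z w)\<^sup>2 d\<mu>\<^sub>2\<close>. The chain rule along the graph turns this into the
  hypothesis of \<open>no_holomorphic_part_iff\<close>.\<close>

lemma gauss_curvature_eq_0_iff:
  assumes u: "u \<in> D"
    and graph: "\<And>v. v \<in> D \<Longrightarrow> \<mu>2 v = F (\<mu>1 v)"
    and F: "(F has_derivative (\<lambda>\<zeta>. a * \<zeta> + c * cnj \<zeta>)) (at (\<mu>1 u))"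
  shows "gauss_curvature x n u = 0 \<longleftrightarrow> a = 0"
proof -
  obtain dw where dw: "(stereo has_derivative dw) (at u)"
    using stereo_differentiable[OF u] by blast
  define d\<mu>1 where
    "d\<mu>1 h = of_real (snd (x u)) * dw h + of_real (snd (dx u h)) * stereo u - fst (dx u h)" for h
  have "(F \<circ> \<mu>1 has_derivative (\<lambda>\<zeta>. a * \<zeta> + c * cnj \<zeta>) \<circ> d\<mu>1) (at u)"
    using diff_chain_at[OF \<mu>1_has_derivative[OF u dw] F] by (simp add: d\<mu>1_def o_def)
  then have d\<mu>2: "(\<mu>2 has_derivative (\<lambda>h. a * d\<mu>1 h + c * cnj (d\<mu>1 h))) (at u)"
    unfolding o_def by (rule has_derivative_transform_within_open[OF _ open_D u]) (simp add: graph)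
  note pos = geodesic_through(1)[OF u]
  obtain p b where shape:
    "\<And>h. - tangent_coord (stereo u) (cov_deriv x n u h) = p * dx_coord u h + b * cnj (dx_coord u h)"
    using obtain_shape_coefficients[OF u pos] by blast
  have p: "p = of_real (Re p)"
    using shape_coefficient_real[OF u pos shape] by (simp add: complex_eq_iff)
  define r where "r = Re p"
  have eq: "(denom u)\<^sup>2 * (a * (of_real r * \<zeta> + b * cnj \<zeta> + \<zeta>) + c * cnj (of_real r * \<zeta> + b * cnj \<zeta> + \<zeta>))
        = of_real r * \<zeta> + b * cnj \<zeta> - \<zeta>" for \<zeta>
  proof -
    obtain h where \<zeta>: "\<zeta> = dx_coord u h" using surjD[OF surj_dx_coord[OF u pos]] by blast
    define d2 where "d2 = (denom u)\<^sup>2 * (a * d\<mu>1 h + c * cnj (d\<mu>1 h))"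
    have M: "of_real r * \<zeta> + b * cnj \<zeta> = - tangent_coord (stereo u) (cov_deriv x n u h)"
      unfolding shape \<zeta> r_def p[symmetric] ..
    have d2: "d2 = of_real (snd (x u)) * dw h - stereo u * of_real (snd (dx u h)) - (stereo u)\<^sup>2 * cnj (fst (dx u h))"
      unfolding d2_def by (rule \<mu>2_derivative[OF u dw d\<mu>2])
    have 1: "of_real r * \<zeta> + b * cnj \<zeta> + \<zeta> = - 2 * d\<mu>1 h"
      unfolding M unfolding tangent_coord_cov_deriv[OF u dw] unfolding \<zeta> tangent_coord_def d\<mu>1_def by (simp add: algebra_simps)
    have 2: "of_real r * \<zeta> + b * cnj \<zeta> - \<zeta> = - 2 * d2"
      unfolding M unfolding tangent_coord_cov_deriv[OF u dw] unfolding \<zeta> tangent_coord_def d2 by (simp add: algebra_simps)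
    show ?thesis unfolding 1 2 d2_def by (simp add: algebra_simps)
  qed
  have "gauss_curvature x n u = r\<^sup>2 - (cmod b)\<^sup>2 - 1"
    using gauss_curvature_eq[OF u pos shape] by (simp add: r_def)
  moreover have "r\<^sup>2 - (cmod b)\<^sup>2 - 1 = 0 \<longleftrightarrow> a = 0"
    by (rule no_holomorphic_part_iff[OF _ eq]) (simp add: geodesic_through(4)[OF u])
  ultimately show ?thesis by simp
qed

end

section \<open>Flatness and anti-holomorphy\<close>

theorem theorem4:
  fixes \<Sigma> :: "'p topology"
    and A :: "'p atlas2"
    and X N :: "'p \<Rightarrow> pt3"
    and f :: "'p \<Rightarrow> complex \<times> complex"
    and U :: "complex set"
    and \<mu>2 :: "complex \<Rightarrow> complex"
  assumes "oriented_C2_immersed_surface \<Sigma> A X N"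
    and "normal_geodesic_congruence \<Sigma> X N f"
    and "congruence_graph \<Sigma> f U \<mu>2"
  shows "flat_surface A X N \<longleftrightarrow> antiholomorphic_on \<mu>2 U"
proof -
  have surf: "C2_surface \<Sigma> A" and imm: "C2_immersion_H3 \<Sigma> A X" and nor: "unit_normal_field \<Sigma> A X N"
    using assms(1) by (auto simp: oriented_C2_immersed_surface_def)
  have "open U" and diff: "\<mu>2 differentiable_on U"
    and image: "f ` topspace \<Sigma> = (\<lambda>\<mu>1. (\<mu>1, \<mu>2 \<mu>1)) ` U"
    using assms(3) by (auto simp: congruence_graph_def)
  have cover: "(\<Union>(D, \<psi>)\<in>A. \<psi> ` D) = topspace \<Sigma>" using surf by (simp add: C2_surface_def)
  have patch: "congruence_patch D (X \<circ> \<psi>) (N \<circ> \<psi>) (fst \<circ> f \<circ> \<psi>) (snd \<circ> f \<circ> \<psi>)"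
    and sub: "\<psi> ` D \<subseteq> topspace \<Sigma>" if chart: "(D, \<psi>) \<in> A" for D \<psi>
  proof -
    show sub: "\<psi> ` D \<subseteq> topspace \<Sigma>" using cover chart by blast
    have "homeomorphic_map (top_of_set D) (subtopology \<Sigma> (\<psi> ` D)) \<psi>" and "open D"
      using surf chart by (auto simp: C2_surface_def)
    then have "continuous_map (top_of_set D) \<Sigma> \<psi>"
      using homeomorphic_imp_continuous_map continuous_map_into_fulltopology by blast
    moreover have "continuous_map \<Sigma> euclidean N" using nor by (simp add: unit_normal_field_def)
    ultimately have "continuous_map (top_of_set D) euclidean (N \<circ> \<psi>)"
      by (rule continuous_map_compose)
    then have cont: "continuous_on D (N \<circ> \<psi>)" by simp
    show "congruence_patch D (X \<circ> \<psi>) (N \<circ> \<psi>) (fst \<circ> f \<circ> \<psi>) (snd \<circ> f \<circ> \<psi>)"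
    proof unfold_locales
      show "open D" "continuous_on D (N \<circ> \<psi>)" by fact+
      show "C2_on (X \<circ> \<psi>) D" using imm chart by (auto simp: C2_immersion_H3_def)
      fix u assume u: "u \<in> D"
      then have p: "\<psi> u \<in> topspace \<Sigma>" using sub by blast
      show "(X \<circ> \<psi>) u \<in> H3" using imm p by (auto simp: C2_immersion_H3_def)
      show "inj (frechet_derivative (X \<circ> \<psi>) (at u))" using imm chart u by (auto simp: C2_immersion_H3_def)
      show "hyp_metric ((X \<circ> \<psi>) u) ((N \<circ> \<psi>) u) ((N \<circ> \<psi>) u) = 1"
        using nor p by (simp add: unit_normal_field_def)
      show "hyp_metric ((X \<circ> \<psi>) u) ((N \<circ> \<psi>) u) (frechet_derivative (X \<circ> \<psi>) (at u) w) = 0" for w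
      proof -
        have "\<forall>(D, \<psi>)\<in>A. \<forall>u\<in>D. \<forall>w.
            hyp_metric (X (\<psi> u)) (N (\<psi> u)) (frechet_derivative (X \<circ> \<psi>) (at u) w) = 0"
          using nor unfolding unit_normal_field_def by blast
        from bspec[OF this chart] show ?thesis using u by (cases w) simp
      qed
      show "((fst \<circ> f \<circ> \<psi>) u, (snd \<circ> f \<circ> \<psi>) u) \<in> LH3_coords"
        "\<exists>r. oriented_geodesic ((fst \<circ> f \<circ> \<psi>) u, (snd \<circ> f \<circ> \<psi>) u) r = (X \<circ> \<psi>) u \<and>
          (oriented_geodesic ((fst \<circ> f \<circ> \<psi>) u, (snd \<circ> f \<circ> \<psi>) u) has_vector_derivative (N \<circ> \<psi>) u) (at r)"
        using assms(2) p unfolding normal_geodesic_congruence_def by auto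
    qed
  qed
  have graph: "fst (f p) \<in> U \<and> snd (f p) = \<mu>2 (fst (f p))" if "p \<in> topspace \<Sigma>" for p
  proof -
    have "f p \<in> (\<lambda>\<mu>1. (\<mu>1, \<mu>2 \<mu>1)) ` U" using that image by blast
    then show ?thesis by auto
  qed
  have flat_at: "gauss_curvature (X \<circ> \<psi>) (N \<circ> \<psi>) u = 0
      \<longleftrightarrow> (\<lambda>z. cnj (\<mu>2 z)) field_differentiable (at (fst (f (\<psi> u))))"
    if chart: "(D, \<psi>) \<in> A" and u: "u \<in> D" for D \<psi> u
  proof -
    interpret congruence_patch D "X \<circ> \<psi>" "N \<circ> \<psi>" "fst \<circ> f \<circ> \<psi>" "snd \<circ> f \<circ> \<psi>"
      by (rule patch[OF chart])
    have inU: "fst (f (\<psi> v)) \<in> U" and gr: "snd (f (\<psi> v)) = \<mu>2 (fst (f (\<psi> v)))" if "v \<in> D" for v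
      using graph sub[OF chart] that by blast+
    have "\<mu>2 differentiable (at (fst (f (\<psi> u))))"
      using diff inU[OF u] at_within_open[OF inU[OF u] \<open>open U\<close>]
      unfolding differentiable_on_def by metis
    then obtain F' where F': "(\<mu>2 has_derivative F') (at (fst (f (\<psi> u))))"
      unfolding differentiable_def by blast
    obtain a c where ac: "\<And>\<zeta>. F' \<zeta> = a * \<zeta> + c * cnj \<zeta>"
      using real_linear_complex_decomposition[OF has_derivative_linear[OF F']] by blast
    have F: "(\<mu>2 has_derivative (\<lambda>\<zeta>. a * \<zeta> + c * cnj \<zeta>)) (at (fst (f (\<psi> u))))"
    proof -
      have "F' = (\<lambda>\<zeta>. a * \<zeta> + c * cnj \<zeta>)" by (rule ext) (rule ac)
      then show ?thesis using F' by (simp only:)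
    qed
    have gr': "(snd \<circ> f \<circ> \<psi>) v = \<mu>2 ((fst \<circ> f \<circ> \<psi>) v)" if "v \<in> D" for v
      using gr[OF that] by simp
    have "gauss_curvature (X \<circ> \<psi>) (N \<circ> \<psi>) u = 0 \<longleftrightarrow> a = 0"
      using F by (intro gauss_curvature_eq_0_iff[OF u gr', of a c]) (simp_all only: o_apply)
    then show ?thesis using complex_differentiable_cnj_iff[OF F] by simp
  qed
  define P where "P z \<longleftrightarrow> (\<lambda>z. cnj (\<mu>2 z)) field_differentiable (at z)" for z
  have "antiholomorphic_on \<mu>2 U \<longleftrightarrow> (\<forall>z\<in>U. P z)"
    unfolding antiholomorphic_on_def holomorphic_on_def P_def
    using at_within_open[OF _ \<open>open U\<close>] by simp
  also have "\<dots> \<longleftrightarrow> (\<forall>p\<in>topspace \<Sigma>. P (fst (f p)))"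
  proof -
    have U: "U = (\<lambda>p. fst (f p)) ` topspace \<Sigma>"
      using arg_cong[OF image, of "(`) fst"] by (simp add: image_image)
    show ?thesis by (subst U) (rule ball_simps)
  qed
  also have "\<dots> \<longleftrightarrow> (\<forall>(D, \<psi>)\<in>A. \<forall>u\<in>D. P (fst (f (\<psi> u))))"
    unfolding cover[symmetric] by blast
  also have "\<dots> \<longleftrightarrow> flat_surface A X N"
    unfolding flat_surface_def
  proof (rule ball_cong[OF refl])
    fix chart assume "chart \<in> A"
    moreover obtain D \<psi> where "chart = (D, \<psi>)" by (cases chart)
    ultimately show "(case chart of (D, \<psi>) \<Rightarrow> \<forall>u\<in>D. P (fst (f (\<psi> u))))
        \<longleftrightarrow> (case chart of (D, \<psi>) \<Rightarrow> \<forall>u\<in>D. gauss_curvature (X \<circ> \<psi>) (N \<circ> \<psi>) u = 0)"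
      using flat_at[of D \<psi>] by (simp add: P_def)
  qed
  finally show ?thesis by blast
qed

end
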